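(* For every integer $n\ge 3$, $$\ell_{\mathcal I}(\mathrm{PU}(n,1))=4.$$ Equivalently, every $g\in\mathrm{PU}(n,1)$ is a product of at most four holomorphic involutions, and some elements of $\mathrm{PU}(n,1)$ cannot be written as products of at most three holomorphic involutions.
   Context: Let $V=\mathbb C^{n+1}$ be endowed with a nondegenerate Hermitian form $\langle\cdot,\cdot\rangle$ of signature $(n,1)$ ($n$ positive directions, one negative direction). Let $\mathrm U(n,1)$ be the group of linear automorphisms of $V$ preserving this form, and $\mathrm{PU}(n,1)=\mathrm U(n,1)/\{e^{i\theta}\mathrm I:\theta\in\mathbb R\}$ (the group of holomorphic isometries of complex hyperbolic $n$-space). A holomorphic involution is an element of $\mathcal I=\{I\in\mathrm{PU}(n,1): I^2=1,\ I\ne 1\}$. For $g\in\mathrm{PU}(n,1)$ put $$\ell_{\mathcal I}(g)=\min\{k\ge 0: g=I_1\cdots I_k,\ I_j\in\mathcal I\},$$ where the identity has length $0$ (empty product) and the value is $+\infty$ if no such $k$ exists, and $$\ell_{\mathcal I}(\mathrm{PU}(n,1))=\sup_{g\in\mathrm{PU}(n,1)}\ell_{\mathcal I}(g).$$ *)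

theory Defs
  imports
    "Jordan_Normal_Form.VS_Connect"
    "HOL-Algebra.Coset"
    "HOL-Library.Extended_Nat"
begin

section \<open>Hermitian forms on complex coordinate space\<close>

text \<open>Forms are linear in the first and conjugate-linear in the second argument. Only their
  values on \<open>carrier_vec N\<close>, that is, on vectors of length \<open>N\<close>, are relevant.\<close>

definition hermitian_form :: "nat \<Rightarrow> (complex vec \<Rightarrow> complex vec \<Rightarrow> complex) \<Rightarrow> bool" where
  "hermitian_form N h \<longleftrightarrow>
    (\<forall>x\<in>carrier_vec N. \<forall>y\<in>carrier_vec N. \<forall>z\<in>carrier_vec N. h (x + y) z = h x z + h y z) \<and>
    (\<forall>c. \<forall>x\<in>carrier_vec N. \<forall>y\<in>carrier_vec N. h (c \<cdot>\<^sub>v x) y = c * h x y) \<and>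
    (\<forall>x\<in>carrier_vec N. \<forall>y\<in>carrier_vec N. h y x = cnj (h x y))"

definition nondegenerate_form :: "nat \<Rightarrow> (complex vec \<Rightarrow> complex vec \<Rightarrow> complex) \<Rightarrow> bool" where
  "nondegenerate_form N h \<longleftrightarrow>
    (\<forall>x\<in>carrier_vec N. (\<forall>y\<in>carrier_vec N. h x y = 0) \<longrightarrow> x = 0\<^sub>v N)"

text \<open>By Sylvester's law of inertia, the numbers \<open>p\<close> and \<open>q\<close> do not depend on the choice of the
  orthogonal basis \<open>bs\<close>. For a Hermitian form the values \<open>h b b\<close> are real.\<close>

definition has_signature ::
    "nat \<Rightarrow> (complex vec \<Rightarrow> complex vec \<Rightarrow> complex) \<Rightarrow> nat \<Rightarrow> nat \<Rightarrow> bool" where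
  "has_signature N h p q \<longleftrightarrow>
    (\<exists>bs. distinct bs \<and>
      vectorspace.basis class_ring (module_vec TYPE(complex) N) (set bs) \<and>
      (\<forall>i<length bs. \<forall>j<length bs. i \<noteq> j \<longrightarrow> h (bs ! i) (bs ! j) = 0) \<and>
      card {i. i < length bs \<and> Re (h (bs ! i) (bs ! i)) > 0} = p \<and>
      card {i. i < length bs \<and> Re (h (bs ! i) (bs ! i)) < 0} = q)"


section \<open>Unitary and projective unitary groups of a form\<close>

definition unitary_group ::
    "nat \<Rightarrow> (complex vec \<Rightarrow> complex vec \<Rightarrow> complex) \<Rightarrow> complex mat monoid" where
  "unitary_group N h =
    \<lparr>carrier = {A \<in> carrier_mat N N. invertible_mat A \<and>
        (\<forall>x\<in>carrier_vec N. \<forall>y\<in>carrier_vec N. h (A *\<^sub>v x) (A *\<^sub>v y) = h x y)},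
     monoid.mult = (*),
     one = 1\<^sub>m N\<rparr>"

definition unit_scalars :: "nat \<Rightarrow> complex mat set" where
  "unit_scalars N = {cis \<theta> \<cdot>\<^sub>m 1\<^sub>m N |\<theta>. True}"

definition projective_unitary_group ::
    "nat \<Rightarrow> (complex vec \<Rightarrow> complex vec \<Rightarrow> complex) \<Rightarrow> complex mat set monoid" where
  "projective_unitary_group N h = unitary_group N h Mod unit_scalars N"


section \<open>Involution length\<close>

definition involutions :: "('a, 'b) monoid_scheme \<Rightarrow> 'a set" where
  "involutions G = {x \<in> carrier G. x \<otimes>\<^bsub>G\<^esub> x = \<one>\<^bsub>G\<^esub> \<and> x \<noteq> \<one>\<^bsub>G\<^esub>}"

definition is_involution_product :: "('a, 'b) monoid_scheme \<Rightarrow> nat \<Rightarrow> 'a \<Rightarrow> bool" where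
  "is_involution_product G k g \<longleftrightarrow>
    (\<exists>xs. length xs = k \<and> set xs \<subseteq> involutions G \<and> g = foldr (\<otimes>\<^bsub>G\<^esub>) xs \<one>\<^bsub>G\<^esub>)"

text \<open>The infimum of a nonempty set of extended naturals is attained, and that of the empty set
  is \<open>\<infinity>\<close>.\<close>

definition involution_length :: "('a, 'b) monoid_scheme \<Rightarrow> 'a \<Rightarrow> enat" where
  "involution_length G g = (INF k\<in>{k. is_involution_product G k g}. enat k)"

definition group_involution_length :: "('a, 'b) monoid_scheme \<Rightarrow> enat" where
  "group_involution_length G = (SUP g\<in>carrier G. involution_length G g)"

end

theory Submission
  imports Defs
begin

text \<open>
  An element of order two of \<open>PU(n, 1)\<close> lifts to a unitary matrix \<open>A\<close> with \<open>A\<^sup>2 = 1\<close>, because a lift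
  whose square is a unit scalar can be divided by a square root of that scalar. So the class of \<open>g\<close> is a
  product of at most \<open>k\<close> involutions if and only if some unit multiple of \<open>g\<close> is a product of \<open>k\<close> involutive
  isometries, where scalar factors \<open>\<plusminus> 1\<close> are allowed. Let \<open>N = n + 1\<close>.

  \<^bold>\<open>Four suffice.\<close> The starting point is the factorisation of a unitary matrix into two block diagonal
  matrices with blocks of size two, the blocks of one straddling those of the other. For an orthogonal
  basis \<open>e\<^sub>1, \<dots>, e\<^sub>N\<close> adapted to \<open>g\<close>, one block after another acts in the plane of \<open>e\<^sub>k\<close> and \<open>e\<^sub>k\<^sub>+\<^sub>1\<close>
  and is chosen to move \<open>e\<^sub>k\<close> to its required image; the odd
  blocks commute with each other, and so do the even ones. In a positive definite plane the required block
  can be taken as a product of two reflections, and what remains at the last basis vector is the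
  determinant, which is made \<open>\<plusminus> 1\<close> by rescaling \<open>g\<close>. Collecting commuting reflections gives four
  involutive isometries (\<open>four_involutives_fixing_negative\<close>).

  The only plane that is not positive definite contains the negative basis vector \<open>e\<close>. If this is the
  first one, only one block is concerned: it has to move \<open>e\<close> to \<open>g e\<close>. In signature \<open>(1, 1)\<close> two
  reflections can do this for \<open>g\<close> or for \<open>- g\<close> if \<open>|Re (\<langle>g e, e\<rangle> / \<langle>e, e\<rangle>)| > 1\<close> (\<open>ex_hyperbolic_factor\<close>). Such an \<open>e\<close> exists
  unless \<open>g\<close> is a scalar: a nonscalar \<open>g\<close> has a null vector \<open>v\<close> with \<open>\<langle>g v, v\<rangle> \<noteq> 0\<close>
  (\<open>ex_null_vector_moved\<close>), a suitable rescaling of \<open>g\<close> by a unit makes the real part of this number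
  nonzero, and for negative \<open>e\<close> near \<open>v\<close> the denominator of the quotient tends to \<open>0\<close>.

  \<^bold>\<open>Three do not suffice.\<close> Let \<open>g\<close> be the complex reflection that multiplies a negative vector \<open>p\<close> by \<open>\<mu>\<close>
  with \<open>\<mu>\<^sup>4 \<noteq> 1\<close>. If \<open>c g = I\<^sub>1 I\<^sub>2 I\<^sub>3\<close> with involutive \<open>I\<^sub>j\<close>, then comparing determinants gives \<open>c\<^sup>4 \<noteq> 1\<close>.
  The product \<open>I\<^sub>1 I\<^sub>2\<close> is conjugate to its inverse, but its square is the scalar \<open>c\<^sup>2\<close> on a positive
  definite subspace of codimension at most two, and for \<open>N \<ge> 4\<close> there is not enough positive definite space for
  the corresponding eigenspace of the inverse (\<open>creflection_not_three_involutives\<close>).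
\<close>

section \<open>Matrices and vectors\<close>

lemma mat_eqI_mult_vec:
  assumes "A \<in> carrier_mat m n" "B \<in> carrier_mat m n"
    and "\<And>x. x \<in> carrier_vec n \<Longrightarrow> A *\<^sub>v x = B *\<^sub>v (x :: 'a :: semiring_1 vec)"
  shows "A = B"
proof (rule eq_matI)
  fix i j assume ij: "i < dim_row B" "j < dim_col B"
  have "A $$ (i, j) = (A *\<^sub>v unit_vec n j) $ i" "B $$ (i, j) = (B *\<^sub>v unit_vec n j) $ i"
    using assms(1,2) ij by auto
  then show "A $$ (i, j) = B $$ (i, j)"
    using assms(3)[of "unit_vec n j"] by simp
qed (use assms in auto)

lemma mult_unit_vec:
  assumes "(A :: 'a :: semiring_1 mat) \<in> carrier_mat m n" "j < n"
  shows "A *\<^sub>v unit_vec n j = col A j"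
  using assms by (intro eq_vecI) auto

lemma two_sided_inverse_of_det_nonzero:
  assumes "A \<in> carrier_mat n n" "det A \<noteq> (0 :: 'a :: field)"
  obtains B where "B \<in> carrier_mat n n" "A * B = 1\<^sub>m n" "B * A = 1\<^sub>m n"
proof -
  have "A \<in> Units (ring_mat TYPE('a) n ())"
    by (rule det_non_zero_imp_unit[OF assms])
  then show thesis using that unfolding Units_def ring_mat_def by auto
qed

lemma vec_diff_eq_0D:
  assumes "x \<in> carrier_vec n" "y \<in> carrier_vec n" "x - y = 0\<^sub>v n"
  shows "x = (y :: 'a :: ring vec)"
proof (rule eq_vecI)
  fix i assume "i < dim_vec y"
  then show "x $ i = y $ i" using arg_cong[OF assms(3), of "\<lambda>v. v $ i"] assms(1,2) by simp
qed (use assms in auto)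

lemma smult_mat_mult_vec:
  assumes "(A :: 'a :: comm_ring_1 mat) \<in> carrier_mat m n" "x \<in> carrier_vec n"
  shows "(c \<cdot>\<^sub>m A) *\<^sub>v x = c \<cdot>\<^sub>v (A *\<^sub>v x)"
  using assms by (intro eq_vecI) auto

lemma smult_smult_mat: "a \<cdot>\<^sub>m (b \<cdot>\<^sub>m A) = (a * b) \<cdot>\<^sub>m (A :: complex mat)"
  by (intro eq_matI) auto

lemma det_map_mat_cnj:
  assumes "A \<in> carrier_mat n n"
  shows "det (map_mat cnj A) = cnj (det A)"
proof -
  have *: "cnj (signof p) = signof p" for p :: "nat \<Rightarrow> nat"
    by (simp add: sign_def)
  have "det (map_mat cnj A) = (\<Sum>p\<in>{p. p permutes {0..<n}}. signof p * (\<Prod>i = 0..<n. cnj (A $$ (i, p i))))"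
    using assms by (subst det_def'[of _ n]) (auto intro!: sum.cong prod.cong arg_cong2[where f = "(*)"])
  then show ?thesis
    unfolding det_def'[OF assms] by (simp add: *)
qed

section \<open>Hermitian forms and orthogonal frames\<close>

locale hermitian_space =
  fixes N :: nat and h :: "complex vec \<Rightarrow> complex vec \<Rightarrow> complex"
  assumes hermitian: "hermitian_form N h"
begin

abbreviation V :: "complex vec set" where "V \<equiv> carrier_vec N"

lemma h_add_left: "x \<in> V \<Longrightarrow> y \<in> V \<Longrightarrow> z \<in> V \<Longrightarrow> h (x + y) z = h x z + h y z"
  and h_smult_left: "x \<in> V \<Longrightarrow> y \<in> V \<Longrightarrow> h (c \<cdot>\<^sub>v x) y = c * h x y"
  and h_cnj: "x \<in> V \<Longrightarrow> y \<in> V \<Longrightarrow> cnj (h x y) = h y x"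
  using hermitian unfolding hermitian_form_def by (blast, blast, metis)

lemma h_add_right: "x \<in> V \<Longrightarrow> y \<in> V \<Longrightarrow> z \<in> V \<Longrightarrow> h z (x + y) = h z x + h z y"
  using h_add_left[of x y z] h_cnj[of "x + y" z] h_cnj[of x z] h_cnj[of y z]
  by (metis add_carrier_vec complex_cnj_add)

lemma h_smult_right: "x \<in> V \<Longrightarrow> y \<in> V \<Longrightarrow> h x (c \<cdot>\<^sub>v y) = cnj c * h x y"
  by (metis h_cnj h_smult_left complex_cnj_mult smult_carrier_vec)

lemma h_diff_left: "x \<in> V \<Longrightarrow> y \<in> V \<Longrightarrow> z \<in> V \<Longrightarrow> h (x - y) z = h x z - h y z"
proof -
  assume V: "x \<in> V" "y \<in> V" "z \<in> V"
  then have "x - y = x + (-1) \<cdot>\<^sub>v y" by auto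
  then show ?thesis
    using h_add_left[of x "(-1) \<cdot>\<^sub>v y" z] h_smult_left[of y z "-1"] V by auto
qed

lemma h_diff_right: "x \<in> V \<Longrightarrow> y \<in> V \<Longrightarrow> z \<in> V \<Longrightarrow> h z (x - y) = h z x - h z y"
  using h_diff_left[of x y z] h_cnj[of "x - y" z] h_cnj[of x z] h_cnj[of y z]
  by (metis minus_carrier_vec complex_cnj_diff)

lemma h_zero_left [simp]: "y \<in> V \<Longrightarrow> h (0\<^sub>v N) y = 0"
  using h_diff_left[of "0\<^sub>v N" "0\<^sub>v N" y] by simp

lemma h_zero_right [simp]: "y \<in> V \<Longrightarrow> h y (0\<^sub>v N) = 0"
  using h_diff_right[of "0\<^sub>v N" "0\<^sub>v N" y] by simp

lemmas h_linear = h_add_left h_add_right h_diff_left h_diff_right h_smult_left h_smult_right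

lemma h_self: "x \<in> V \<Longrightarrow> complex_of_real (Re (h x x)) = h x x"
  using h_cnj[of x x] by (simp add: complex_eq_iff)

lemma h_eq_0_commute: "x \<in> V \<Longrightarrow> y \<in> V \<Longrightarrow> h x y = 0 \<longleftrightarrow> h y x = 0"
  using h_cnj[of x y] by auto

definition dual :: "complex vec \<Rightarrow> complex vec" where
  "dual y = vec N (\<lambda>i. h (unit_vec N i) y)"

lemma dual_carrier [simp]: "dual y \<in> V"
  by (simp add: dual_def)

text \<open>Writing the form as a scalar product turns orthogonality to given vectors into a system of
  linear equations.\<close>

lemma h_eq_scalar_prod:
  assumes x: "x \<in> V" and y: "y \<in> V"
  shows "h x y = x \<bullet> dual y"
proof -
  let ?t = "\<lambda>k. vec N (\<lambda>i. if i < k then x $ i else 0)"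
  have "k \<le> N \<Longrightarrow> h (?t k) y = (\<Sum>i<k. x $ i * h (unit_vec N i) y)" for k
  proof (induction k)
    case 0
    have "?t 0 = 0\<^sub>v N" by auto
    then show ?case using y by simp
  next
    case (Suc k)
    have "?t (Suc k) = ?t k + x $ k \<cdot>\<^sub>v unit_vec N k"
      using Suc.prems by (intro eq_vecI) (auto simp: less_Suc_eq)
    then show ?case using Suc y by (simp add: h_linear)
  qed
  from this[of N] have "h (?t N) y = (\<Sum>i<N. x $ i * h (unit_vec N i) y)" by simp
  moreover have "?t N = x" using x by auto
  ultimately show ?thesis
    using x by (simp add: scalar_prod_def dual_def lessThan_atLeast0)
qed

text \<open>Fewer than \<open>N\<close> homogeneous linear equations in \<open>N\<close> unknowns have a nontrivial solution: padded
  with zero rows, their matrix is singular.\<close>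

lemma ex_orthogonal_vector:
  assumes fs: "set fs \<subseteq> V" and len: "length fs < N"
  obtains x where "x \<in> V" "x \<noteq> 0\<^sub>v N" "\<And>f. f \<in> set fs \<Longrightarrow> h x f = 0"
proof -
  let ?c = "\<lambda>i. if i < length fs then dual (fs ! i) else 0\<^sub>v N"
  let ?M = "mat\<^sub>r N N (\<lambda>i. if i = N - 1 then 0\<^sub>v N else ?c i)"
  have "det ?M = 0"
    using len by (intro det_row_0) auto
  then obtain x where x: "x \<in> V" "x \<noteq> 0\<^sub>v N" "?M *\<^sub>v x = 0\<^sub>v N"
    using det_0_iff_vec_prod_zero_field[of ?M N] by auto
  have "h x (fs ! i) = 0" if i: "i < length fs" for i
  proof (cases "i = N - 1")
    case True
    then show ?thesis using i len by simp
  next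
    case False
    have "row ?M i \<bullet> x = 0"
      using arg_cong[OF x(3), of "\<lambda>v. v $ i"] i len by simp
    moreover have "row ?M i = dual (fs ! i)"
      using i len False by (intro eq_vecI) (auto simp: dual_def)
    ultimately show ?thesis
      using fs i x(1) by (subst h_eq_scalar_prod) (auto simp: comm_scalar_prod[of x N] nth_mem subset_iff)
  qed
  then show thesis
    using x that by (metis in_set_conv_nth)
qed

definition orthogonal_frame :: "complex vec list \<Rightarrow> bool" where
  "orthogonal_frame es \<longleftrightarrow> length es = N \<and> set es \<subseteq> V \<and>
    (\<forall>i<N. \<forall>j<N. i \<noteq> j \<longrightarrow> h (es ! i) (es ! j) = 0) \<and> (\<forall>i<N. h (es ! i) (es ! i) \<noteq> 0)"

context
  fixes es assumes frame: "orthogonal_frame es"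
begin

lemma frame_length: "length es = N"
  and frame_carrier: "i < N \<Longrightarrow> es ! i \<in> V"
  and frame_orthogonal: "i < N \<Longrightarrow> j < N \<Longrightarrow> i \<noteq> j \<Longrightarrow> h (es ! i) (es ! j) = 0"
  and frame_nonisotropic: "i < N \<Longrightarrow> h (es ! i) (es ! i) \<noteq> 0"
  using frame unfolding orthogonal_frame_def by (auto simp: subset_iff)

abbreviation E where "E \<equiv> mat_of_cols N es"

lemma E_carrier: "E \<in> carrier_mat N N"
  using frame_length by (simp add: carrier_matI)

lemma col_E: "i < N \<Longrightarrow> col E i = es ! i"
  using frame_length frame_carrier by simp

lemma h_frame_expansion:
  assumes c: "c \<in> V" and y: "y \<in> V"
  shows "h (E *\<^sub>v c) y = (\<Sum>i<N. c $ i * h (es ! i) y)"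
proof -
  have "h (E *\<^sub>v c) y = (E *\<^sub>v c) \<bullet> dual y"
    using E_carrier c y by (intro h_eq_scalar_prod) auto
  also have "\<dots> = dual y \<bullet> (E *\<^sub>v c)"
    using E_carrier c by (intro comm_scalar_prod[of _ N]) auto
  also have "\<dots> = (E\<^sup>T *\<^sub>v dual y) \<bullet> c"
    using E_carrier c by (simp add: transpose_vec_mult_scalar[of E N N])
  also have "\<dots> = (\<Sum>i<N. (es ! i \<bullet> dual y) * c $ i)"
    unfolding scalar_prod_def[of _ c] using E_carrier c col_E
    by (intro sum.cong) (auto simp: lessThan_atLeast0)
  also have "\<dots> = (\<Sum>i<N. c $ i * h (es ! i) y)"
    using frame_carrier y by (intro sum.cong) (auto simp: h_eq_scalar_prod)
  finally show ?thesis .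
qed

lemma h_frame_coordinate:
  assumes c: "c \<in> V" and j: "j < N"
  shows "h (E *\<^sub>v c) (es ! j) = c $ j * h (es ! j) (es ! j)"
proof -
  have "h (E *\<^sub>v c) (es ! j) = (\<Sum>i<N. if i = j then c $ j * h (es ! j) (es ! j) else 0)"
    unfolding h_frame_expansion[OF c frame_carrier[OF j]]
    using frame_orthogonal j by (intro sum.cong) auto
  then show ?thesis using j by simp
qed

lemma h_frame_self:
  assumes c: "c \<in> V"
  shows "Re (h (E *\<^sub>v c) (E *\<^sub>v c)) = (\<Sum>i<N. (cmod (c $ i))\<^sup>2 * Re (h (es ! i) (es ! i)))"
proof -
  have Ec: "E *\<^sub>v c \<in> V" using E_carrier c by auto
  have "c $ i * h (es ! i) (E *\<^sub>v c) = of_real ((cmod (c $ i))\<^sup>2 * Re (h (es ! i) (es ! i)))"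
    if i: "i < N" for i
  proof -
    have "h (es ! i) (E *\<^sub>v c) = cnj (c $ i) * h (es ! i) (es ! i)"
      using h_frame_coordinate[OF c i] h_cnj[OF Ec frame_carrier[OF i]]
        h_cnj[OF frame_carrier[OF i] frame_carrier[OF i]] by simp
    then show ?thesis
      using h_self[OF frame_carrier[OF i]] complex_norm_square[of "c $ i"]
      by (simp add: mult.assoc)
  qed
  then show ?thesis
    unfolding h_frame_expansion[OF c Ec] Re_sum by (intro sum.cong) auto
qed

lemma det_E_nonzero: "det E \<noteq> 0"
proof
  assume "det E = 0"
  then obtain c where c: "c \<in> V" "c \<noteq> 0\<^sub>v N" "E *\<^sub>v c = 0\<^sub>v N"
    using det_0_iff_vec_prod_zero_field[OF E_carrier] by auto
  have "c $ j = 0" if "j < N" for j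
    using h_frame_coordinate[OF c(1) that] frame_nonisotropic[OF that] frame_carrier[OF that] c(3)
    by simp
  then have "c = 0\<^sub>v N" using c(1) by (intro eq_vecI) auto
  with c(2) show False ..
qed

lemma frame_expansion:
  assumes x: "x \<in> V"
  obtains c where "c \<in> V" "x = E *\<^sub>v c"
proof -
  obtain B where B: "B \<in> carrier_mat N N" "E * B = 1\<^sub>m N"
    by (rule two_sided_inverse_of_det_nonzero[OF E_carrier det_E_nonzero])
  have "x = E *\<^sub>v (B *\<^sub>v x)"
    using B x E_carrier by (metis assoc_mult_mat_vec one_mult_mat_vec)
  then show thesis using that[of "B *\<^sub>v x"] B x by auto
qed

lemma frame_zeroI:
  assumes x: "x \<in> V" and 0: "\<And>i. i < N \<Longrightarrow> h x (es ! i) = 0"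
  shows "x = 0\<^sub>v N"
proof -
  obtain c where c: "c \<in> V" "x = E *\<^sub>v c" using frame_expansion[OF x] .
  have "c = 0\<^sub>v N"
    using h_frame_coordinate[OF c(1)] 0 c frame_nonisotropic by (intro eq_vecI) auto
  then show ?thesis using c E_carrier by auto
qed

lemma frame_mat_eqI:
  assumes A: "A \<in> carrier_mat N N" and B: "B \<in> carrier_mat N N"
    and eq: "\<And>i. i < N \<Longrightarrow> A *\<^sub>v es ! i = B *\<^sub>v es ! i"
  shows "A = B"
proof -
  obtain E' where E': "E' \<in> carrier_mat N N" "E * E' = 1\<^sub>m N"
    by (rule two_sided_inverse_of_det_nonzero[OF E_carrier det_E_nonzero])
  have "A * E = B * E"
  proof (rule mat_col_eqI)
    fix i assume "i < dim_col (B * E)"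
    then have i: "i < N" using frame_length by simp
    then show "col (A * E) i = col (B * E) i"
      unfolding col_mult2[OF A E_carrier i] col_mult2[OF B E_carrier i] col_E[OF i] by (rule eq)
  qed (use A B in auto)
  then have "A * (E * E') = B * (E * E')"
    unfolding assoc_mult_mat[OF A E_carrier E'(1), symmetric]
      assoc_mult_mat[OF B E_carrier E'(1), symmetric] by (rule arg_cong)
  then show ?thesis using E'(2) A B by simp
qed

text \<open>In the basis given by the frame the matrix is diagonal.\<close>

lemma frame_eigen_det:
  assumes A: "A \<in> carrier_mat N N"
    and eq: "\<And>i. i < N \<Longrightarrow> A *\<^sub>v es ! i = d i \<cdot>\<^sub>v es ! i"
  shows "det A = (\<Prod>i<N. d i)"
proof -
  let ?D = "mat N N (\<lambda>(i, j). if i = j then d j else 0)"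
  have D: "?D \<in> carrier_mat N N" by simp
  have "A * E = E * ?D"
  proof (rule mat_col_eqI)
    fix i assume "i < dim_col (E * ?D)"
    then have i: "i < N" by simp
    have "col ?D i = d i \<cdot>\<^sub>v unit_vec N i"
      using i by (intro eq_vecI) auto
    then have "col (E * ?D) i = d i \<cdot>\<^sub>v es ! i"
      using i E_carrier col_E[OF i] by (simp add: col_mult2[OF E_carrier D i] mult_mat_vec[OF E_carrier] mult_unit_vec[OF E_carrier i])
    then show "col (A * E) i = col (E * ?D) i"
      using A E_carrier eq[OF i] col_E[OF i] i by (simp add: col_mult2[OF A E_carrier i])
  qed (use A E_carrier in auto)
  then have "det E * det A = det E * det ?D"
    by (metis det_mult[OF A E_carrier] det_mult[OF E_carrier D] mult.commute)
  then have "det A = det ?D" using det_E_nonzero unfolding mult_cancel_left by blast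
  also have "\<dots> = prod_list (diag_mat ?D)"
    by (rule det_upper_triangular[OF _ D]) auto
  also have "diag_mat ?D = map d [0..<N]"
    by (simp add: diag_mat_def)
  also have "prod_list (map d [0..<N]) = (\<Prod>i<N. d i)"
    by (simp add: prod.list_conv_set_nth lessThan_atLeast0)
  finally show ?thesis .
qed

end

abbreviation U :: "complex mat set" where "U \<equiv> carrier (unitary_group N h)"

lemma U_carrier: "A \<in> U \<Longrightarrow> A \<in> carrier_mat N N"
  and U_preserves: "A \<in> U \<Longrightarrow> x \<in> V \<Longrightarrow> y \<in> V \<Longrightarrow> h (A *\<^sub>v x) (A *\<^sub>v y) = h x y"
  by (auto simp: unitary_group_def)

lemma U_mult_vec [simp]: "A \<in> U \<Longrightarrow> x \<in> V \<Longrightarrow> A *\<^sub>v x \<in> V"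
  using U_carrier mult_mat_vec_carrier by blast

lemma U_mult_mult_vec: "A \<in> U \<Longrightarrow> B \<in> U \<Longrightarrow> x \<in> V \<Longrightarrow> (A * B) *\<^sub>v x = A *\<^sub>v (B *\<^sub>v x)"
  using U_carrier by (meson assoc_mult_mat_vec)

section \<open>Complex reflections\<close>

text \<open>The complex reflection with mirror \<open>u\<^sup>\<bottom>\<close> and multiplier \<open>\<mu>\<close>: it fixes the vectors orthogonal to \<open>u\<close>
  and multiplies \<open>u\<close> by \<open>\<mu>\<close>.\<close>

definition creflection :: "complex vec \<Rightarrow> complex \<Rightarrow> complex mat" where
  "creflection u \<mu> =
    mat N N (\<lambda>(i, j). (unit_vec N j + ((\<mu> - 1) * h (unit_vec N j) u / h u u) \<cdot>\<^sub>v u) $ i)"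

lemma creflection_carrier [simp]: "creflection u \<mu> \<in> carrier_mat N N"
  by (simp add: creflection_def)

lemma creflection_apply:
  assumes u: "u \<in> V" and x: "x \<in> V"
  shows "creflection u \<mu> *\<^sub>v x = x + ((\<mu> - 1) * h x u / h u u) \<cdot>\<^sub>v u"
proof (rule eq_vecI)
  fix i assume "i < dim_vec (x + ((\<mu> - 1) * h x u / h u u) \<cdot>\<^sub>v u)"
  then have i: "i < N" using u by simp
  let ?c = "(\<mu> - 1) / h u u"
  have "(creflection u \<mu> *\<^sub>v x) $ i
      = (\<Sum>j<N. ((if i = j then 1 else 0) + ?c * dual u $ j * u $ i) * x $ j)"
    using i u x by (simp add: creflection_def scalar_prod_def lessThan_atLeast0 dual_def)
  also have "\<dots> = (\<Sum>j<N. (if i = j then x $ j else 0) + ?c * u $ i * (x $ j * dual u $ j))"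
    by (intro sum.cong) (auto simp: algebra_simps)
  also have "\<dots> = x $ i + ?c * u $ i * (\<Sum>j<N. x $ j * dual u $ j)"
    using i by (simp add: sum.distrib sum_distrib_left)
  also have "(\<Sum>j<N. x $ j * dual u $ j) = h x u"
    unfolding h_eq_scalar_prod[OF x u] scalar_prod_def by (simp add: lessThan_atLeast0 dual_def)
  finally show "(creflection u \<mu> *\<^sub>v x) $ i = (x + ((\<mu> - 1) * h x u / h u u) \<cdot>\<^sub>v u) $ i"
    using i u x by simp
qed (use u x in \<open>auto simp: creflection_def\<close>)

lemma creflection_self:
  "u \<in> V \<Longrightarrow> h u u \<noteq> 0 \<Longrightarrow> creflection u \<mu> *\<^sub>v u = \<mu> \<cdot>\<^sub>v u"
  by (intro eq_vecI) (auto simp: creflection_apply field_simps)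

lemma creflection_orthogonal:
  "u \<in> V \<Longrightarrow> x \<in> V \<Longrightarrow> h x u = 0 \<Longrightarrow> creflection u \<mu> *\<^sub>v x = x"
  by (auto simp: creflection_apply)

lemma creflection_preserves:
  assumes u: "u \<in> V" "h u u \<noteq> 0" and \<mu>: "cmod \<mu> = 1" and xy: "x \<in> V" "y \<in> V"
  shows "h (creflection u \<mu> *\<^sub>v x) (creflection u \<mu> *\<^sub>v y) = h x y"
proof -
  let ?k = "h u u"
  have k: "cnj ?k = ?k" using h_cnj[OF u(1) u(1)] .
  have \<mu>': "\<mu> * cnj \<mu> = 1" using complex_norm_square[of \<mu>] \<mu> by simp
  let ?a = "(\<mu> - 1) * h x u / ?k" and ?b = "(\<mu> - 1) * h y u / ?k"
  have b: "cnj ?b = (cnj \<mu> - 1) * h u y / ?k"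
    using k h_cnj[OF xy(2) u(1)] by simp
  have "h (creflection u \<mu> *\<^sub>v x) (creflection u \<mu> *\<^sub>v y)
      = h x y + cnj ?b * h x u + ?a * h u y + ?a * cnj ?b * ?k"
    using u xy by (simp add: creflection_apply h_linear algebra_simps)
  also have "\<dots> = h x y + (\<mu> * cnj \<mu> - 1) * h x u * h u y / ?k"
    unfolding b using u(2) by (simp add: field_simps)
  finally show ?thesis using \<mu>' by simp
qed

abbreviation reflection :: "complex vec \<Rightarrow> complex mat" where
  "reflection u \<equiv> creflection u (- 1)"

lemma reflection_involutive:
  assumes u: "u \<in> V" "h u u \<noteq> 0"
  shows "reflection u * reflection u = 1\<^sub>m N"
proof (rule mat_eqI_mult_vec[of _ N N])
  fix x assume x: "x \<in> V"
  let ?y = "x + (- 2 * h x u / h u u) \<cdot>\<^sub>v u"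
  have y: "?y \<in> V" "h ?y u = - h x u" using u x by (auto simp: h_linear)
  have "(reflection u * reflection u) *\<^sub>v x = reflection u *\<^sub>v ?y"
    using u x by (simp add: assoc_mult_mat_vec[of _ N N _ N] creflection_apply)
  also have "\<dots> = ?y + (2 * h x u / h u u) \<cdot>\<^sub>v u"
    unfolding creflection_apply[OF u(1) y(1)] y(2) by simp
  also have "\<dots> = x" using u x by (intro eq_vecI) auto
  finally show "(reflection u * reflection u) *\<^sub>v x = 1\<^sub>m N *\<^sub>v x" using x by simp
qed (auto intro: mult_carrier_mat[of _ N N])

text \<open>If \<open>x\<close> and \<open>y\<close> have the same norm and a real product, then \<open>x + y\<close> is orthogonal to \<open>x - y\<close>, so that
  the reflection in \<open>x - y\<close> fixes half their sum and negates half their difference. Both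
  factorisations below are built from this observation: to move \<open>e\<close> to \<open>w\<close> by two reflections, one looks
  for an intermediate vector of the same norm whose products with \<open>e\<close> and with \<open>w\<close> are real.\<close>

lemma reflection_swaps:
  assumes xy: "x \<in> V" "y \<in> V" and eq: "h x x = h y y" and sym: "h x y = h y x"
    and ne: "h (x - y) (x - y) \<noteq> 0"
  shows "reflection (x - y) *\<^sub>v x = y"
proof -
  have "h (x - y) (x - y) = 2 * h x (x - y)"
    using xy eq sym by (simp add: h_linear)
  then have "(- 1 - 1) * h x (x - y) / h (x - y) (x - y) = - 1"
    using ne by simp
  then have "reflection (x - y) *\<^sub>v x = x + (- 1) \<cdot>\<^sub>v (x - y)"
    using xy by (simp only: creflection_apply minus_carrier_vec)
  then show ?thesis using xy by auto
qed

text \<open>Conjugating the reflection in \<open>u\<close> by an isometry \<open>P\<close> gives the reflection in \<open>P u\<close>.\<close>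

lemma reflection_commute:
  assumes u: "u \<in> V" and P: "P \<in> U" and Pu: "P *\<^sub>v u = u"
  shows "P * creflection u \<mu> = creflection u \<mu> * P"
proof (rule mat_eqI_mult_vec[of _ N N])
  have Pc: "P \<in> carrier_mat N N" using P by (rule U_carrier)
  then show "P * creflection u \<mu> \<in> carrier_mat N N" "creflection u \<mu> * P \<in> carrier_mat N N"
    by (auto intro: mult_carrier_mat[of _ N N])
  fix x assume x: "x \<in> V"
  have h: "h (P *\<^sub>v x) u = h x u" using U_preserves[OF P x u] Pu by simp
  have "(P * creflection u \<mu>) *\<^sub>v x = P *\<^sub>v x + ((\<mu> - 1) * h x u / h u u) \<cdot>\<^sub>v u"
    using Pc u x Pu
    by (simp add: assoc_mult_mat_vec[of _ N N _ N] creflection_apply mult_add_distrib_mat_vec[of _ N N] mult_mat_vec[OF Pc])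
  also have "\<dots> = (creflection u \<mu> * P) *\<^sub>v x"
    using Pc u x h by (simp add: assoc_mult_mat_vec[of _ N N _ N] creflection_apply)
  finally show "(P * creflection u \<mu>) *\<^sub>v x = (creflection u \<mu> * P) *\<^sub>v x" .
qed

end

section \<open>Forms with one negative direction\<close>

locale lorentz_space = hermitian_space +
  assumes signature: "has_signature N h (N - 1) 1" and dim: "N \<ge> 2"
begin

lemma ex_signature_frame:
  obtains bs i0 where "orthogonal_frame bs" "i0 < N" "Re (h (bs ! i0) (bs ! i0)) < 0"
    "\<And>i. i < N \<Longrightarrow> i \<noteq> i0 \<Longrightarrow> Re (h (bs ! i) (bs ! i)) > 0"
proof -
  interpret vs: vec_space "TYPE(complex)" N .
  obtain bs where bs: "distinct bs" "vs.basis (set bs)"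
    "\<forall>i<length bs. \<forall>j<length bs. i \<noteq> j \<longrightarrow> h (bs ! i) (bs ! j) = 0"
    and P: "card {i. i < length bs \<and> Re (h (bs ! i) (bs ! i)) > 0} = N - 1" (is "card ?P = _")
    and Q: "card {i. i < length bs \<and> Re (h (bs ! i) (bs ! i)) < 0} = 1" (is "card ?Q = _")
    using signature unfolding has_signature_def by blast
  have len: "length bs = N"
    using vs.dim_basis[OF finite_set bs(2)] bs(1) vs.dim_is_n by (simp add: distinct_card)
  have V: "set bs \<subseteq> V" using bs(2) unfolding vs.basis_def by simp
  have "card (?P \<union> ?Q) = N"
    using P Q dim by (subst card_Un_disjoint) auto
  then have all: "?P \<union> ?Q = {..<N}"
    using len by (intro card_subset_eq) auto
  obtain i0 where i0: "?Q = {i0}" using Q by (rule card_1_singletonE)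
  show thesis
  proof (rule that[of bs i0])
    have "h (bs ! i) (bs ! i) \<noteq> 0" if "i < N" for i
    proof -
      have "i \<in> ?P \<union> ?Q" using all that by blast
      then show ?thesis by auto
    qed
    then show "orthogonal_frame bs"
      unfolding orthogonal_frame_def using len V bs(3) by simp
    show "i0 < N" "Re (h (bs ! i0) (bs ! i0)) < 0" using i0 len by auto
    show "Re (h (bs ! i) (bs ! i)) > 0" if "i < N" "i \<noteq> i0" for i
    proof -
      have "i \<in> ?P \<union> ?Q" "i \<notin> ?Q" using all i0 that by auto
      then show ?thesis by auto
    qed
  qed
qed

text \<open>Otherwise the form would be nonpositive on the span of \<open>e\<close> and \<open>x\<close>. This span has dimension two, so it
  contains a nonzero vector \<open>y\<close> orthogonal to the negative vector \<open>b\<close> of a diagonalising basis, and the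
  form is positive on \<open>b\<^sup>\<bottom>\<close>.\<close>

lemma h_pos_if_orthogonal_to_negative:
  assumes e: "e \<in> V" "Re (h e e) < 0" and x: "x \<in> V" "h x e = 0" "x \<noteq> 0\<^sub>v N"
  shows "Re (h x x) > 0"
proof -
  obtain bs i0 where bs: "orthogonal_frame bs" and i0: "i0 < N"
    and pos: "\<And>i. i < N \<Longrightarrow> i \<noteq> i0 \<Longrightarrow> Re (h (bs ! i) (bs ! i)) > 0"
    using ex_signature_frame by blast
  let ?E = "mat_of_cols N bs"
  note frame = frame_carrier[OF bs] frame_nonisotropic[OF bs]
  let ?b = "bs ! i0"
  have pos_b: "Re (h y y) > 0" if y: "y \<in> V" "h y ?b = 0" "y \<noteq> 0\<^sub>v N" for y
  proof -
    obtain c where c: "c \<in> V" "y = ?E *\<^sub>v c" using frame_expansion[OF bs y(1)] .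
    have c0: "c $ i0 = 0"
      using h_frame_coordinate[OF bs c(1) i0] y(2) c(2) frame(2)[OF i0] by simp
    have nn: "(cmod (c $ i))\<^sup>2 * Re (h (bs ! i) (bs ! i)) \<ge> 0" if "i < N" for i
      using pos[OF that] c0 by (cases "i = i0") (auto simp: less_imp_le)
    have "\<exists>i<N. c $ i \<noteq> 0"
    proof (rule ccontr)
      assume "\<not> (\<exists>i<N. c $ i \<noteq> 0)"
      then have "c = 0\<^sub>v N" using c(1) by (intro eq_vecI) auto
      then show False using y(3) c(2) E_carrier[OF bs] by auto
    qed
    then obtain i where i: "i < N" "c $ i \<noteq> 0" by blast
    then have "(cmod (c $ i))\<^sup>2 * Re (h (bs ! i) (bs ! i)) > 0"
      using pos c0 by (cases "i = i0") auto
    then show ?thesis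
      unfolding c(2) h_frame_self[OF bs c(1)] using i nn
      by (intro sum_pos2[of _ i]) auto
  qed
  \<comment> \<open>The combination of \<open>x\<close> and \<open>e\<close> in which the contributions of \<open>?b\<close> cancel.\<close>
  define y where "y = h e ?b \<cdot>\<^sub>v x - h x ?b \<cdot>\<^sub>v e"
  have b: "?b \<in> V" using frame(1)[OF i0] .
  have y: "y \<in> V" "h y ?b = 0" using e x b by (auto simp: y_def h_linear)
  have e_b: "h e ?b \<noteq> 0"
  proof
    assume "h e ?b = 0"
    moreover have "e \<noteq> 0\<^sub>v N" using e by auto
    ultimately show False using pos_b[OF e(1)] e(2) by simp
  qed
  have ex: "h e x = 0" using h_eq_0_commute e(1) x by blast
  have "h y y = h e ?b * cnj (h e ?b) * h x x + h x ?b * cnj (h x ?b) * h e e"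
    using e x b ex by (simp add: y_def h_linear algebra_simps)
  then have hy: "Re (h y y) = (cmod (h e ?b))\<^sup>2 * Re (h x x) + (cmod (h x ?b))\<^sup>2 * Re (h e e)"
    by (simp add: complex_norm_square[symmetric])
  show ?thesis
  proof (cases "y = 0\<^sub>v N")
    case True
    have "h y e = - (h x ?b * h e e)" using e x b by (simp add: y_def h_linear)
    then have "h x ?b = 0" using True e by auto
    then have "h e ?b * x $ i = 0" if "i < N" for i
      using arg_cong[OF True, of "\<lambda>v. v $ i"] that e(1) x(1) by (simp add: y_def)
    then have "x = 0\<^sub>v N" using e_b x(1) by (intro eq_vecI) auto
    with x(3) show ?thesis ..
  next
    case False
    then have "Re (h y y) > 0" using pos_b y by blast
    moreover have "(cmod (h x ?b))\<^sup>2 * Re (h e e) \<le> 0"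
      using e(2) by (simp add: mult_nonneg_nonpos)
    ultimately have "(cmod (h e ?b))\<^sup>2 * Re (h x x) > 0" using hy by linarith
    then show ?thesis by (simp add: zero_less_mult_iff)
  qed
qed

lemma ex_unit_multiple:
  assumes "x \<in> V" "Re (h x x) > 0"
  obtains y where "y = complex_of_real (1 / sqrt (Re (h x x))) \<cdot>\<^sub>v x" "y \<in> V" "h y y = 1"
proof -
  define s where "s = 1 / sqrt (Re (h x x))"
  have s: "s * (s * Re (h x x)) = 1" using assms(2) by (simp add: s_def)
  have "h (of_real s \<cdot>\<^sub>v x) (of_real s \<cdot>\<^sub>v x) = of_real (s * (s * Re (h x x)))"
    using assms(1) h_self[OF assms(1)] by (simp add: h_linear)
  then show thesis using that assms(1) unfolding s by (simp add: s_def)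
qed

lemma ex_negative_vector:
  obtains e where "e \<in> V" "h e e = - 1"
proof -
  obtain bs i0 where bs: "orthogonal_frame bs" "i0 < N" "Re (h (bs ! i0) (bs ! i0)) < 0"
    using ex_signature_frame by blast
  let ?b = "bs ! i0"
  have b: "?b \<in> V" using frame_carrier bs by simp
  define s where "s = 1 / sqrt (- Re (h ?b ?b))"
  have s: "s * (s * Re (h ?b ?b)) = - 1" using bs(3) by (simp add: s_def)
  have "h (of_real s \<cdot>\<^sub>v ?b) (of_real s \<cdot>\<^sub>v ?b) = of_real (s * (s * Re (h ?b ?b)))"
    using h_self[OF b] b by (simp add: h_linear)
  then show thesis using that[of "of_real s \<cdot>\<^sub>v ?b"] b unfolding s by simp
qed

lemma nondegenerate:
  assumes x: "x \<in> V" and 0: "\<And>y. y \<in> V \<Longrightarrow> h x y = 0"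
  shows "x = 0\<^sub>v N"
proof -
  obtain e where e: "e \<in> V" "h e e = - 1" by (rule ex_negative_vector)
  show ?thesis
    using h_pos_if_orthogonal_to_negative[OF e(1) _ x 0[OF e(1)]] e(2) 0[OF x] by force
qed

text \<open>An isometry of a nondegenerate form is injective, hence invertible.\<close>

lemma U_iff:
  "A \<in> U \<longleftrightarrow> A \<in> carrier_mat N N \<and> (\<forall>x\<in>V. \<forall>y\<in>V. h (A *\<^sub>v x) (A *\<^sub>v y) = h x y)"
proof -
  have "invertible_mat A"
    if A: "A \<in> carrier_mat N N" and pres: "\<forall>x\<in>V. \<forall>y\<in>V. h (A *\<^sub>v x) (A *\<^sub>v y) = h x y"
  proof -
    have "det A \<noteq> 0"
    proof
      assume "det A = 0"
      then obtain x where x: "x \<in> V" "x \<noteq> 0\<^sub>v N" "A *\<^sub>v x = 0\<^sub>v N"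
        using det_0_iff_vec_prod_zero_field[OF A] by auto
      have "h x y = 0" if "y \<in> V" for y
      proof -
        have "h (A *\<^sub>v x) (A *\<^sub>v y) = 0" using x(3) A that by simp
        then show ?thesis using pres x(1) that by simp
      qed
      then show False using nondegenerate x by blast
    qed
    then obtain B where "B \<in> carrier_mat N N" "A * B = 1\<^sub>m N" "B * A = 1\<^sub>m N"
      by (rule two_sided_inverse_of_det_nonzero[OF A])
    then show ?thesis
      using A unfolding invertible_mat_def inverts_mat_def square_mat.simps by auto
  qed
  then show ?thesis unfolding unitary_group_def by auto
qed

lemma U_one: "1\<^sub>m N \<in> U"
  by (simp add: U_iff)

lemma U_mult: "A \<in> U \<Longrightarrow> B \<in> U \<Longrightarrow> A * B \<in> U"
  unfolding U_iff by (auto simp: assoc_mult_mat_vec[of _ N N _ N])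

lemma U_smult:
  assumes "A \<in> U" "cmod c = 1"
  shows "c \<cdot>\<^sub>m A \<in> U"
proof -
  have A: "A \<in> carrier_mat N N" using U_carrier assms(1) .
  have "cnj c * c = 1" using complex_norm_square[of c] assms(2) by (simp add: mult.commute)
  moreover have "(c \<cdot>\<^sub>m A) *\<^sub>v x = c \<cdot>\<^sub>v (A *\<^sub>v x)" if "x \<in> V" for x
    by (rule smult_mat_mult_vec[OF A that])
  ultimately show ?thesis
    using assms A unfolding U_iff by (simp add: h_linear mult.assoc[symmetric])
qed

lemma U_creflection: "u \<in> V \<Longrightarrow> h u u \<noteq> 0 \<Longrightarrow> cmod \<mu> = 1 \<Longrightarrow> creflection u \<mu> \<in> U"
  unfolding U_iff using creflection_preserves by simp

lemma U_inverse:
  assumes A: "A \<in> U"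
  obtains B where "B \<in> U" "A * B = 1\<^sub>m N" "B * A = 1\<^sub>m N"
proof -
  have Ac: "A \<in> carrier_mat N N" using U_carrier[OF A] .
  obtain B where B: "A * B = 1\<^sub>m N" "B * A = 1\<^sub>m (dim_row B)"
    using A Ac unfolding unitary_group_def invertible_mat_def inverts_mat_def by auto
  have row: "dim_row B = N" using arg_cong[OF B(2), of dim_col] Ac by simp
  have col: "dim_col B = N" using arg_cong[OF B(1), of dim_col] by simp
  have Bc: "B \<in> carrier_mat N N" using row col by blast
  have "h (B *\<^sub>v x) (B *\<^sub>v y) = h x y" if "x \<in> V" "y \<in> V" for x y
  proof -
    have "A *\<^sub>v (B *\<^sub>v z) = z" if "z \<in> V" for z
      using B(1) assoc_mult_mat_vec[OF Ac Bc that] that by simp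
    then show ?thesis using U_preserves[OF A, of "B *\<^sub>v x" "B *\<^sub>v y"] Bc that by simp
  qed
  then show thesis using that[of B] B row Bc U_iff by simp
qed

text \<open>With the Gram matrix \<open>G\<close> of the unit vectors, preservation of the form reads
  \<open>A\<^sup>T G A' = G\<close> with \<open>A'\<close> the entrywise conjugate of \<open>A\<close>, and \<open>det G \<noteq> 0\<close>.\<close>

lemma U_det_unit:
  assumes A: "A \<in> U"
  shows "cmod (det A) = 1"
proof -
  have Ac: "A \<in> carrier_mat N N" using U_carrier[OF A] .
  let ?G = "mat N N (\<lambda>(i, j). h (unit_vec N i) (unit_vec N j))"
  let ?A = "map_mat cnj A"
  have G: "?G \<in> carrier_mat N N" by simp
  have A': "?A \<in> carrier_mat N N" using Ac by simp
  have dual: "?G *\<^sub>v map_vec cnj y = dual y" if y: "y \<in> V" for y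
  proof (rule eq_vecI)
    fix i assume "i < dim_vec (dual y)"
    then have i: "i < N" by (simp add: dual_def)
    have "dual y $ i = cnj (y \<bullet> dual (unit_vec N i))"
      using i y h_cnj[of y "unit_vec N i"] h_eq_scalar_prod[of y "unit_vec N i"]
      by (simp add: dual_def[of y])
    also have "\<dots> = (\<Sum>j = 0..<N. cnj (y $ j) * h (unit_vec N i) (unit_vec N j))"
      unfolding scalar_prod_def using y by (simp add: dual_def h_cnj)
    also have "\<dots> = (?G *\<^sub>v map_vec cnj y) $ i"
      using i y by (simp add: scalar_prod_def mult.commute)
    finally show "(?G *\<^sub>v map_vec cnj y) $ i = dual y $ i" ..
  qed (simp add: dual_def)
  have "det ?G \<noteq> 0"
  proof
    assume "det ?G = 0"
    then obtain w where w: "w \<in> V" "w \<noteq> 0\<^sub>v N" "?G *\<^sub>v w = 0\<^sub>v N"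
      using det_0_iff_vec_prod_zero_field[OF G] by auto
    let ?y = "map_vec cnj w"
    have y: "?y \<in> V" using w(1) by simp
    have "map_vec cnj ?y = w" by (intro eq_vecI) auto
    then have "dual ?y = 0\<^sub>v N" using dual[OF y] w(3) by simp
    then have "h x ?y = 0" if "x \<in> V" for x
      using h_eq_scalar_prod[OF that y] that by simp
    then have "?y = 0\<^sub>v N"
      using nondegenerate[OF y] h_eq_0_commute[OF y] by blast
    then have "w = 0\<^sub>v N" using w(1) by (auto simp: vec_eq_iff)
    with w(2) show False ..
  qed
  moreover have "A\<^sup>T * (?G * ?A) = ?G"
  proof (rule eq_matI)
    fix i j assume "i < dim_row ?G" "j < dim_col ?G"
    then have ij: "i < N" "j < N" by auto
    have "(A\<^sup>T * (?G * ?A)) $$ (i, j) = col A i \<bullet> (?G *\<^sub>v col ?A j)"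
      using Ac ij by (simp add: col_mult2[OF G A'])
    also have "col ?A j = map_vec cnj (col A j)"
      using Ac ij by auto
    also have "col A i \<bullet> (?G *\<^sub>v map_vec cnj (col A j)) = h (col A i) (col A j)"
      using Ac ij dual[of "col A j"] h_eq_scalar_prod[of "col A i" "col A j"] by simp
    also have "\<dots> = h (unit_vec N i) (unit_vec N j)"
      using U_preserves[OF A, of "unit_vec N i" "unit_vec N j"] mult_unit_vec[OF Ac] ij by simp
    finally show "(A\<^sup>T * (?G * ?A)) $$ (i, j) = ?G $$ (i, j)" using ij by simp
  qed (use Ac in auto)
  moreover have "det (A\<^sup>T * (?G * ?A)) = det A * (det ?G * cnj (det A))"
    unfolding det_mult[OF transpose_carrier_mat[THEN iffD2, OF Ac] mult_carrier_mat[OF G A']]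
      det_mult[OF G A'] det_transpose[OF Ac] det_map_mat_cnj[OF Ac] ..
  ultimately have "det A * cnj (det A) = 1" by simp
  then have "(cmod (det A))\<^sup>2 = 1"
    by (metis complex_norm_square of_real_eq_1_iff)
  then have "cmod (det A) = 1 \<or> cmod (det A) = - 1" by (simp add: power2_eq_1_iff)
  then show ?thesis using norm_ge_zero[of "det A"] by linarith
qed

lemma U_assoc: "A \<in> U \<Longrightarrow> B \<in> U \<Longrightarrow> C \<in> U \<Longrightarrow> A * B * C = A * (B * C)"
  using U_carrier by (intro assoc_mult_mat[of _ N N _ N _ N])

lemma U_one_left: "A \<in> U \<Longrightarrow> 1\<^sub>m N * A = A" and U_one_right: "A \<in> U \<Longrightarrow> A * 1\<^sub>m N = A"
  by (auto dest: U_carrier)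

section \<open>Involutive isometries\<close>

definition involutives :: "complex mat set" where
  "involutives = {A \<in> U. A * A = 1\<^sub>m N}"

lemma involutives_U: "A \<in> involutives \<Longrightarrow> A \<in> U"
  and involutives_square: "A \<in> involutives \<Longrightarrow> A * A = 1\<^sub>m N"
  by (auto simp: involutives_def)

lemma involutives_cancel: "A \<in> involutives \<Longrightarrow> B \<in> U \<Longrightarrow> A * (A * B) = B"
  using U_assoc[of A A B] involutives_U involutives_square U_one_left by metis

lemma involutives_cancel_vec: "A \<in> involutives \<Longrightarrow> x \<in> V \<Longrightarrow> A *\<^sub>v (A *\<^sub>v x) = x"
  using U_mult_mult_vec[of A A x] involutives_U involutives_square by simp

lemma one_involutive: "1\<^sub>m N \<in> involutives"
  using U_one U_one_left by (simp add: involutives_def)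

lemma involutives_mult:
  assumes A: "A \<in> involutives" and B: "B \<in> involutives" and comm: "A * B = B * A"
  shows "A * B \<in> involutives"
proof -
  note U = involutives_U[OF A] involutives_U[OF B]
  have "A * B * (A * B) = A * (B * (A * B))" using U by (intro U_assoc U_mult)
  also have "A * B = B * A" by (rule comm)
  also have "B * (B * A) = A" by (rule involutives_cancel[OF B U(1)])
  also have "A * A = 1\<^sub>m N" by (rule involutives_square[OF A])
  finally show ?thesis using U U_mult[OF U] by (simp add: involutives_def comm)
qed

lemma reflection_involutives: "u \<in> V \<Longrightarrow> h u u \<noteq> 0 \<Longrightarrow> reflection u \<in> involutives"
  using U_creflection reflection_involutive by (simp add: involutives_def)

lemma det_U_mult: "A \<in> U \<Longrightarrow> B \<in> U \<Longrightarrow> det (A * B) = det A * det B"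
  using U_carrier by (intro det_mult)

lemma det_involutives:
  assumes "A \<in> involutives"
  shows "det A \<in> {1, - 1}"
proof -
  have "det A * det A = 1"
    using det_U_mult[of A A] involutives_U[OF assms] involutives_square[OF assms] by simp
  then have "(det A)\<^sup>2 = 1" by (simp add: power2_eq_square)
  then show ?thesis by (simp add: power2_eq_1_iff)
qed

lemma involutives_adjoint:
  assumes A: "A \<in> involutives" and xy: "x \<in> V" "y \<in> V"
  shows "h (A *\<^sub>v x) y = h x (A *\<^sub>v y)"
  using U_preserves[OF involutives_U[OF A] xy(1) U_mult_vec[OF involutives_U[OF A] xy(2)]]
  unfolding involutives_cancel_vec[OF A xy(2)] .

definition orthogonal_list :: "complex vec list \<Rightarrow> bool" where
  "orthogonal_list es \<longleftrightarrow>
    set es \<subseteq> V \<and> sorted_wrt (\<lambda>x y. h x y = 0) es \<and> (\<forall>x\<in>set es. h x x \<noteq> 0)"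

lemma orthogonal_list_frame:
  assumes "orthogonal_list es" "length es = N"
  shows "orthogonal_frame es"
proof -
  have V: "es ! i \<in> V" if "i < N" for i
    using assms that by (auto simp: orthogonal_list_def subset_iff)
  have lt: "h (es ! i) (es ! j) = 0" if "i < j" "j < N" for i j
    using assms that by (auto simp: orthogonal_list_def sorted_wrt_iff_nth_less)
  have "h (es ! i) (es ! j) = 0" if "i < N" "j < N" "i \<noteq> j" for i j
    using lt[of i j] lt[of j i] h_eq_0_commute[OF V V] that by (cases "i < j") auto
  then show ?thesis
    using assms unfolding orthogonal_frame_def by (auto simp: orthogonal_list_def)
qed

lemma orthogonal_list_snoc:
  "orthogonal_list (es @ [f]) \<longleftrightarrow>
    orthogonal_list es \<and> f \<in> V \<and> h f f \<noteq> 0 \<and> (\<forall>x\<in>set es. h x f = 0)"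
  by (auto simp: orthogonal_list_def sorted_wrt_append)

lemma mult_linear_combination:
  assumes "A \<in> U" "x \<in> V" "y \<in> V" "A *\<^sub>v x = x" "A *\<^sub>v y = y"
  shows "A *\<^sub>v (a \<cdot>\<^sub>v x + b \<cdot>\<^sub>v y) = a \<cdot>\<^sub>v x + b \<cdot>\<^sub>v y"
  using assms U_carrier[OF assms(1)]
  by (simp add: mult_add_distrib_mat_vec[of _ N N] mult_mat_vec[of _ N N])

lemma mult_diff_fixed:
  assumes "A \<in> U" "x \<in> V" "y \<in> V" "A *\<^sub>v x = x" "A *\<^sub>v y = y"
  shows "A *\<^sub>v (x - y) = x - y"
  using assms U_carrier[OF assms(1)] by (simp add: mult_minus_distrib_mat_vec[of _ N N])

section \<open>Products of four involutive isometries\<close>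

text \<open>One Gram-Schmidt step. The sign of \<open>r\<close> is chosen so that \<open>\<langle>f, w\<rangle> = r\<close> is real and different from
  \<open>1\<close>; then \<open>f\<close> and \<open>w\<close> are exchanged by the reflection in the vector \<open>f - w\<close>, which is not isotropic. The
  negative vector \<open>n\<close> forces everything orthogonal to \<open>fs\<close> to be positive.\<close>

lemma ex_pivot:
  assumes es: "orthogonal_list (fs @ [e])" and len: "Suc (length fs) < N"
    and neg: "n \<in> set fs" "Re (h n n) < 0" and e: "h e e = 1"
    and w: "w \<in> V" "\<And>x. x \<in> set fs \<Longrightarrow> h w x = 0"
  obtains f r where "f \<in> V" "h f f = 1" "\<And>x. x \<in> set (fs @ [e]) \<Longrightarrow> h f x = 0"
    "r \<le> 0" "w = h w e \<cdot>\<^sub>v e + complex_of_real r \<cdot>\<^sub>v f"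
proof -
  have V: "set fs \<subseteq> V" "e \<in> V" "n \<in> V" using es neg by (auto simp: orthogonal_list_def)
  have orth: "h e x = 0" if "x \<in> set fs" for x
    using es that V h_eq_0_commute[of e x] by (auto simp: orthogonal_list_snoc)
  define d where "d = w - h w e \<cdot>\<^sub>v e"
  have d: "d \<in> V" "w = h w e \<cdot>\<^sub>v e + d" using w V by (auto simp: d_def)
  have d_orth: "h d x = 0" if "x \<in> set (fs @ [e])" for x
    using that w V e orth by (auto simp: d_def h_linear subset_iff)
  show thesis
  proof (cases "d = 0\<^sub>v N")
    case True
    obtain x where x: "x \<in> V" "x \<noteq> 0\<^sub>v N" "\<And>y. y \<in> set (fs @ [e]) \<Longrightarrow> h x y = 0"
      using ex_orthogonal_vector[of "fs @ [e]"] V len by auto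
    have "Re (h x x) > 0"
      using h_pos_if_orthogonal_to_negative[OF V(3) neg(2) x(1) _ x(2)] x(3) neg(1) by simp
    then obtain f where f: "f = complex_of_real (1 / sqrt (Re (h x x))) \<cdot>\<^sub>v x" "f \<in> V" "h f f = 1"
      using ex_unit_multiple x(1) by blast
    have "h f y = 0" if "y \<in> set (fs @ [e])" for y
    proof -
      have "y \<in> V" using that V by auto
      then show ?thesis using x that unfolding f(1) by (simp only: h_smult_left mult_zero_right)
    qed
    moreover have "complex_of_real 0 \<cdot>\<^sub>v f = d" using f(2) True by (intro eq_vecI) auto
    ultimately show thesis using that[of f 0] f(2,3) d(2) by simp
  next
    case False
    have pos: "Re (h d d) > 0"
      using h_pos_if_orthogonal_to_negative[OF V(3) neg(2) d(1) _ False] d_orth neg(1) by simp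
    then obtain f where f: "f = complex_of_real (1 / sqrt (Re (h d d))) \<cdot>\<^sub>v d" "f \<in> V" "h f f = 1"
      using ex_unit_multiple d(1) by blast
    let ?f = "(- 1) \<cdot>\<^sub>v f" and ?r = "- sqrt (Re (h d d))"
    have "h ?f y = 0" if "y \<in> set (fs @ [e])" for y
    proof -
      have "y \<in> V" using that V by auto
      then show ?thesis using d_orth[OF that] f d unfolding f(1)
        by (simp only: h_smult_left mult_zero_right smult_carrier_vec)
    qed
    moreover have "complex_of_real ?r \<cdot>\<^sub>v ?f = d"
      using pos d(1) unfolding f(1) by (intro eq_vecI) auto
    moreover have "h ?f ?f = 1" using f(2,3) by (simp only: h_linear smult_carrier_vec) simp
    ultimately show thesis using that[of ?f ?r] f(2) d pos by simp
  qed
qed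

text \<open>The induction peels off one basis vector at a time. In the orthogonal complement of \<open>fs\<close>, which is
  positive definite, a product of two reflections \<open>A\<close>, \<open>B\<close> in vectors of the plane spanned by \<open>e\<close> and a new
  unit vector \<open>f\<close> moves \<open>e\<close> to the preimage of \<open>e\<close> under \<open>g\<close>. The isometry \<open>g A B\<close> then also fixes \<open>e\<close>. The
  induction hypothesis is applied to its inverse, \<open>B A g\<^sup>-\<^sup>1 = P Q R S\<close>, so that \<open>g = S R Q P B A\<close>.

  The inverse makes the two sides alternate, and this is the reason for the last two conclusions. The
  factors \<open>P\<close> and \<open>Q\<close> fix \<open>e\<close> and \<open>f\<close>, hence commute with \<open>A\<close> and \<open>B\<close>, and
  \<open>g = S R (Q B) (P A)\<close> is again a product of four involutive isometries. Its first two factors \<open>S\<close> and \<open>R\<close>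
  fix \<open>fs\<close> and \<open>e\<close>, which is what the preceding step of the recursion needs.

  When \<open>fs\<close> and \<open>e\<close> span the space, \<open>g\<close> multiplies \<open>e\<close> by its determinant \<open>\<plusminus> 1\<close> and is itself involutive.\<close>

lemma four_involutives_fixing_negative:
  assumes "orthogonal_list (fs @ [e])" "length fs < N"
    and "n \<in> set fs" "Re (h n n) < 0" and "h e e = 1"
    and "g \<in> U" "det g \<in> {1, - 1}" "\<forall>x\<in>set fs. g *\<^sub>v x = x"
  shows "\<exists>P\<in>involutives. \<exists>Q\<in>involutives. \<exists>R\<in>involutives. \<exists>S\<in>involutives.
    g = P * (Q * (R * S)) \<and> (\<forall>A\<in>{P, Q, R, S}. \<forall>x\<in>set fs. A *\<^sub>v x = x) \<and>
    P *\<^sub>v e = e \<and> Q *\<^sub>v e = e"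
  using assms
proof (induction "N - Suc (length fs)" arbitrary: fs e g)
  case 0
  note es = 0(2) and neg = 0(4,5) and e = 0(6) and g = 0(7-9)
  have len: "Suc (length fs) = N" using 0(1,3) by simp
  have frame: "orthogonal_frame (fs @ [e])"
    using orthogonal_list_frame[OF es] len by simp
  have V: "set fs \<subseteq> V" "e \<in> V" using es by (auto simp: orthogonal_list_def)
  have orth: "h e x = 0" if "x \<in> set fs" for x
    using es that V h_eq_0_commute[of e x] by (auto simp: orthogonal_list_snoc)
  let ?c = "h (g *\<^sub>v e) e"
  have ge: "g *\<^sub>v e \<in> V" using g V by simp
  have "g *\<^sub>v e - ?c \<cdot>\<^sub>v e = 0\<^sub>v N"
  proof (rule frame_zeroI[OF frame])
    fix i assume i: "i < N"
    let ?x = "(fs @ [e]) ! i"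
    have x: "?x \<in> V" using frame_carrier[OF frame i] .
    have "?x \<in> set (fs @ [e])" using i len nth_mem[of i "fs @ [e]"] by simp
    then consider "?x \<in> set fs" | "?x = e" by auto
    then show "h (g *\<^sub>v e - ?c \<cdot>\<^sub>v e) ?x = 0"
    proof cases
      case 1
      then have "h (g *\<^sub>v e) ?x = h (g *\<^sub>v e) (g *\<^sub>v ?x)" using g(3) by simp
      then show ?thesis using 1 U_preserves[OF g(1) V(2) x] orth ge x V by (simp add: h_linear)
    qed (use e ge V in \<open>simp add: h_linear\<close>)
  qed (simp only: minus_carrier_vec smult_carrier_vec ge V(2))
  then have ge_eq: "g *\<^sub>v e = ?c \<cdot>\<^sub>v e"
    by (intro vec_diff_eq_0D[OF ge]) (simp only: smult_carrier_vec V(2))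
  let ?d = "\<lambda>i. if i < length fs then 1 else ?c"
  have eig: "g *\<^sub>v (fs @ [e]) ! i = ?d i \<cdot>\<^sub>v (fs @ [e]) ! i" if "i < N" for i
  proof (cases "i < length fs")
    case True
    then show ?thesis using g(3) by (simp add: nth_append)
  next
    case False
    then have "i = length fs" using that len by simp
    then show ?thesis using ge_eq by simp
  qed
  have "det g = (\<Prod>i<Suc (length fs). ?d i)"
    using frame_eigen_det[OF frame U_carrier[OF g(1)] eig] len by simp
  also have "\<dots> = ?c" by simp
  finally have c: "?c \<in> {1, - 1}" using g(2) by simp
  have "g * g = 1\<^sub>m N"
  proof (rule frame_mat_eqI[OF frame])
    fix i assume i: "i < N"
    let ?x = "(fs @ [e]) ! i"
    have x: "?x \<in> V" using frame_carrier[OF frame i] .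
    have "(g * g) *\<^sub>v ?x = g *\<^sub>v (?d i \<cdot>\<^sub>v ?x)"
      using U_mult_mult_vec[OF g(1) g(1) x] eig[OF i] by simp
    also have "\<dots> = ?d i \<cdot>\<^sub>v (?d i \<cdot>\<^sub>v ?x)"
      using mult_mat_vec[OF U_carrier[OF g(1)] x] eig[OF i] by simp
    also have "\<dots> = ?x" using c by (auto simp: smult_smult_assoc)
    finally show "(g * g) *\<^sub>v ?x = 1\<^sub>m N *\<^sub>v ?x" using x by simp
  qed (use U_mult[OF g(1) g(1)] U_carrier in auto)
  then have gi: "g \<in> involutives" using g(1) by (simp add: involutives_def)
  show ?case
    by (rule bexI[OF _ one_involutive], rule bexI[OF _ one_involutive], rule bexI[OF _ gi],
      rule bexI[OF _ one_involutive])
      (use g V U_carrier[OF g(1)] in \<open>auto simp: subset_iff\<close>)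
next
  case (Suc m)
  note IH = Suc(1) and es = Suc(3) and neg = Suc(5,6) and e = Suc(7) and g = Suc(8-10)
  have len: "Suc (length fs) < N" using Suc(2) by simp
  have V: "set fs \<subseteq> V" "e \<in> V" using es by (auto simp: orthogonal_list_def)
  have orth: "h e x = 0" if "x \<in> set fs" for x
    using es that V h_eq_0_commute[of e x] by (auto simp: orthogonal_list_snoc)
  obtain g' where g': "g' \<in> U" "g * g' = 1\<^sub>m N" "g' * g = 1\<^sub>m N" by (rule U_inverse[OF g(1)])
  define w where "w = g' *\<^sub>v e"
  have w: "w \<in> V" using g' V by (simp add: w_def)
  have gw: "g *\<^sub>v w = e" using U_mult_mult_vec[OF g(1) g'(1) V(2)] g'(2) V by (simp add: w_def)
  have hw: "h w w = 1" using U_preserves[OF g(1) w w] gw e by simp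
  have w_orth: "h w x = 0" if "x \<in> set fs" for x
    using U_preserves[OF g(1) w, of x] gw g(3) that V orth by (auto simp: subset_iff)
  obtain f r where f: "f \<in> V" "h f f = 1" "\<And>x. x \<in> set (fs @ [e]) \<Longrightarrow> h f x = 0"
    and r: "r \<le> 0" and w_eq: "w = h w e \<cdot>\<^sub>v e + complex_of_real r \<cdot>\<^sub>v f"
    using ex_pivot[OF es len neg e w w_orth] by blast
  have fe: "h f e = 0" "h e f = 0" using f(3)[of e] h_eq_0_commute[OF f(1) V(2)] by auto
  have hwf: "h w f = r" using fe f V w_eq
    by (metis (no_types, lifting) add_0 h_add_left h_smult_left mult.right_neutral mult_zero_right smult_carrier_vec)
  have hfw: "h f w = r" using h_cnj[OF w f(1)] hwf by simp
  let ?a = "f - w" and ?b = "e - f"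
  have a: "?a \<in> V" "h ?a ?a \<noteq> 0"
  proof -
    have "h ?a ?a = of_real (2 - 2 * r)" using f w hw hwf hfw by (simp add: h_linear)
    then show "h ?a ?a \<noteq> 0" using r by (simp only: of_real_eq_0_iff)
  qed (use f w in auto)
  have b: "?b \<in> V" "h ?b ?b \<noteq> 0" using f V e fe by (auto simp: h_linear)
  let ?A = "reflection ?a" and ?B = "reflection ?b"
  have A: "?A \<in> involutives" and B: "?B \<in> involutives"
    using reflection_involutives a b by blast+
  note AU = involutives_U[OF A] and BU = involutives_U[OF B]
  have Be: "?B *\<^sub>v e = f"
    using b e f fe V by (intro reflection_swaps) auto
  have Af: "?A *\<^sub>v f = w"
    using a f w hw hwf hfw by (intro reflection_swaps) auto
  have fixA: "?A *\<^sub>v x = x" and fixB: "?B *\<^sub>v x = x" if "x \<in> set fs" for x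
  proof -
    have x: "x \<in> V" using that V by auto
    have 0: "h x f = 0" "h x e = 0" "h x w = 0"
      using f(3)[of x] orth[OF that] w_orth[OF that] h_eq_0_commute x f(1) V(2) w that by auto
    show "?A *\<^sub>v x = x" "?B *\<^sub>v x = x"
      using 0 x f w V a b by (auto intro!: creflection_orthogonal simp: h_linear)
  qed
  \<comment> \<open>The inverse of \<open>g A B\<close>, which fixes \<open>fs\<close> and \<open>e\<close>.\<close>
  define k where "k = ?B * (?A * g')"
  have k: "k \<in> U" using AU BU g' by (simp add: k_def U_mult)
  have det_k: "det k \<in> {1, - 1}"
  proof -
    have "det g * det g' = 1" using det_U_mult[OF g(1) g'(1)] g'(2) by simp
    then have "det g' \<in> {1, - 1}" using g(2) by (auto simp: minus_equation_iff)
    then show ?thesis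
      using det_involutives[OF A] det_involutives[OF B] AU BU g'(1)
      by (auto simp: k_def det_U_mult U_mult)
  qed
  have k_fix: "k *\<^sub>v x = x" if "x \<in> set (fs @ [e])" for x
  proof -
    have x: "x \<in> V" using that V by auto
    have k_x: "k *\<^sub>v x = ?B *\<^sub>v (?A *\<^sub>v (g' *\<^sub>v x))"
      using AU BU g' x by (simp add: k_def U_mult_mult_vec U_mult)
    show ?thesis
    proof (cases "x = e")
      case True
      then show ?thesis
        using k_x involutives_cancel_vec[OF A f(1)] involutives_cancel_vec[OF B V(2)] Af Be
        by (simp add: w_def)
    next
      case False
      then have x': "x \<in> set fs" using that by simp
      then have "g' *\<^sub>v x = g' *\<^sub>v (g *\<^sub>v x)" using g(3) by simp
      also have "\<dots> = x" using U_mult_mult_vec[OF g'(1) g(1) x] g'(3) x by simp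
      finally show ?thesis using k_x fixA[OF x'] fixB[OF x'] by simp
    qed
  qed
  have es': "orthogonal_list ((fs @ [e]) @ [f])"
    using es f V h_eq_0_commute[OF f(1)] by (subst orthogonal_list_snoc) (auto simp: subset_iff)
  have "m = N - Suc (length (fs @ [e]))" "length (fs @ [e]) < N" "n \<in> set (fs @ [e])"
    using Suc(2) len neg by auto
  from IH[OF this(1) es' this(2,3) neg(2) f(2) k det_k] k_fix obtain P Q R S where PQRS: "P \<in> involutives" "Q \<in> involutives" "R \<in> involutives" "S \<in> involutives"
    and k_eq: "k = P * (Q * (R * S))"
    and fix4: "\<forall>A\<in>{P, Q, R, S}. \<forall>x\<in>set (fs @ [e]). A *\<^sub>v x = x"
    and fix2: "P *\<^sub>v f = f" "Q *\<^sub>v f = f"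
    by blast
  note PU = involutives_U[OF PQRS(1)] and QU = involutives_U[OF PQRS(2)]
    and RU = involutives_U[OF PQRS(3)] and SU = involutives_U[OF PQRS(4)]
  have Pe: "P *\<^sub>v e = e" "Q *\<^sub>v e = e" using fix4 by auto
  have Pa: "P *\<^sub>v ?a = ?a" 
    using mult_diff_fixed[OF PU f(1) w fix2(1)] mult_linear_combination[OF PU V(2) f(1) Pe(1) fix2(1)] w_eq by metis
  have Qb: "Q *\<^sub>v ?b = ?b"
    using mult_diff_fixed[OF QU V(2) f(1) Pe(2) fix2(2)] .
  have Pb: "P *\<^sub>v ?b = ?b"
    using mult_diff_fixed[OF PU V(2) f(1) Pe(1) fix2(1)] .
  have QB: "Q * ?B = ?B * Q" and PA: "P * ?A = ?A * P" and PB: "P * ?B = ?B * P"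
    using reflection_commute a b PU QU Pa Qb Pb by auto
  have "S * (R * (Q * P)) * (P * (Q * (R * S))) = 1\<^sub>m N"
    using PQRS PU QU RU SU by (simp add: U_assoc U_mult involutives_cancel involutives_square)
  then have inv: "S * (R * (Q * P)) * k = 1\<^sub>m N" using k_eq by simp
  have "k * (g * (?A * ?B)) = 1\<^sub>m N"
  proof -
    have "g' * (g * X) = X" if "X \<in> U" for X
      using U_assoc[OF g'(1) g(1) that] g'(3) U_one_left[OF that] by simp
    then show ?thesis
      using AU BU g'(1) g(1) A B by (simp add: k_def U_assoc U_mult involutives_cancel involutives_square)
  qed
  then have "S * (R * (Q * P)) = S * (R * (Q * P)) * (k * (g * (?A * ?B)))"
    using U_one_right PU QU RU SU U_mult by simp
  also have "\<dots> = (S * (R * (Q * P)) * k) * (g * (?A * ?B))"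
    using k AU BU g(1) PU QU RU SU by (intro U_assoc[symmetric] U_mult)
  also have "\<dots> = g * (?A * ?B)"
    unfolding inv using AU BU g(1) by (intro U_one_left U_mult)
  finally have eq: "g * (?A * ?B) = S * (R * (Q * P))" ..
  have "g = g * (?A * ?B) * (?B * ?A)"
    using AU BU g(1) A B by (simp add: U_assoc U_mult involutives_cancel involutives_square U_one_right)
  also have "\<dots> = S * (R * (Q * (P * (?B * ?A))))"
    unfolding eq using AU BU PU QU RU SU by (simp add: U_assoc U_mult)
  also have "P * (?B * ?A) = ?B * (P * ?A)"
    using U_assoc[OF PU BU AU] U_assoc[OF BU PU AU] PB by simp
  also have "Q * (?B * (P * ?A)) = (Q * ?B) * (P * ?A)"
    using AU BU PU QU by (intro U_assoc[symmetric] U_mult)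
  finally have g_eq: "g = S * (R * ((Q * ?B) * (P * ?A)))" .
  have QBi: "Q * ?B \<in> involutives" and PAi: "P * ?A \<in> involutives"
    using involutives_mult PQRS A B QB PA by blast+
  have fix_prod: "(Q * ?B) *\<^sub>v x = x" "(P * ?A) *\<^sub>v x = x" if "x \<in> set fs" for x
    using fix4 that V fixA[OF that] fixB[OF that] PU QU AU BU
    by (auto simp: U_mult_mult_vec subset_iff)
  show ?case
    by (rule bexI[OF _ PQRS(4)], rule bexI[OF _ PQRS(3)], rule bexI[OF _ QBi], rule bexI[OF _ PAi])
      (use g_eq fix4 fix_prod in auto)
qed

definition four_involutive_product :: "complex mat \<Rightarrow> bool" where
  "four_involutive_product g \<longleftrightarrow> (\<exists>P\<in>involutives. \<exists>Q\<in>involutives. \<exists>R\<in>involutives. \<exists>S\<in>involutives.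
    g = P * (Q * (R * S)))"

text \<open>In a plane of signature \<open>(1, 1)\<close> not every vector \<open>w\<close> of the norm of \<open>e\<close> is the image of \<open>e\<close> under two
  reflections in negative or positive vectors; with \<open>\<alpha> = \<langle>w, e\<rangle> / \<langle>e, e\<rangle>\<close> a sufficient condition
  is \<open>Re \<alpha> > 1\<close>. The required
  intermediate vector is proportional to \<open>e\<^sub>1 = (\<alpha> - 1) e + (\<alpha>' - 1) w\<close> with \<open>\<alpha>'\<close> the conjugate of \<open>\<alpha>\<close>.
  Indeed \<open>\<langle>e\<^sub>1, e\<rangle> = \<langle>e\<^sub>1, w\<rangle> = 1 - |\<alpha>|\<^sup>2\<close> is real, and
  \<open>\<langle>e\<^sub>1, e\<^sub>1\<rangle> = 2 (Re \<alpha> - 1) (1 - |\<alpha>|\<^sup>2)\<close> is negative.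

  The vector \<open>f\<close> completes \<open>e\<close> to an orthogonal basis of the plane. An isometry that fixes \<open>e\<close> and \<open>f\<close> fixes
  \<open>w\<close>, and by the last conclusion it fixes both reflection vectors.\<close>

lemma ex_hyperbolic_factor:
  assumes e: "e \<in> V" "h e e = - 1" and w: "w \<in> V" "h w w = - 1" and re: "Re (h w e) < - 1"
  obtains a b f c where "a \<in> V" "h a a \<noteq> 0" "b \<in> V" "h b b \<noteq> 0"
    "f \<in> V" "h f f = 1" "h e f = 0" "w = - h w e \<cdot>\<^sub>v e + c \<cdot>\<^sub>v f"
    "reflection a *\<^sub>v (reflection b *\<^sub>v e) = w"
    "\<forall>A\<in>U. A *\<^sub>v e = e \<longrightarrow> A *\<^sub>v w = w \<longrightarrow> A *\<^sub>v a = a \<and> A *\<^sub>v b = b"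
proof -
  define \<alpha> where "\<alpha> = - h w e"
  have we: "h w e = - \<alpha>" and ew: "h e w = - cnj \<alpha>"
    using h_cnj[OF w(1) e(1)] by (auto simp: \<alpha>_def)
  have a1: "Re \<alpha> > 1" using re by (simp add: \<alpha>_def)
  define \<delta> where "\<delta> = (cmod \<alpha>)\<^sup>2 - 1"
  have aa: "\<alpha> * cnj \<alpha> = complex_of_real (\<delta> + 1)" by (simp add: \<delta>_def complex_norm_square[symmetric])
  have \<delta>: "\<delta> > 0"
  proof -
    have "1 < cmod \<alpha>" using a1 complex_Re_le_cmod[of \<alpha>] by linarith
    then show ?thesis by (simp add: \<delta>_def power_gt1 one_less_power)
  qed
  define d where "d = w - \<alpha> \<cdot>\<^sub>v e"
  have d: "d \<in> V" using e w by (simp add: d_def)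
  have de: "h d e = 0" using e w we by (simp add: d_def h_linear)
  have hdd: "h d d = of_real \<delta>"
    using e w we ew aa by (simp add: d_def h_linear)
  obtain f where f: "f = complex_of_real (1 / sqrt (Re (h d d))) \<cdot>\<^sub>v d" "f \<in> V" "h f f = 1"
    using ex_unit_multiple[OF d] hdd \<delta> by auto
  have fe: "h e f = 0"
  proof -
    have "h e d = 0" using h_eq_0_commute[OF d e(1)] de by blast
    then show ?thesis unfolding f(1) using d e(1) by (simp only: h_smult_right mult_zero_right)
  qed
  have w_eq: "w = \<alpha> \<cdot>\<^sub>v e + complex_of_real (sqrt \<delta>) \<cdot>\<^sub>v f"
    using e w \<delta> hdd unfolding f(1) d_def by (intro eq_vecI) auto
  define e1 where "e1 = (\<alpha> - 1) \<cdot>\<^sub>v e + (cnj \<alpha> - 1) \<cdot>\<^sub>v w"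
  have e1: "e1 \<in> V" using e w by (simp add: e1_def)
  have e1e: "h e1 e = of_real (- \<delta>)"
    using e w we aa by (simp add: e1_def h_linear algebra_simps)
  have e1w: "h e1 w = of_real (- \<delta>)"
    using e w ew aa by (simp add: e1_def h_linear algebra_simps)
  define \<rho> where "\<rho> = 2 * (Re \<alpha> - 1) * \<delta>"
  have \<rho>: "\<rho> > 0" using a1 \<delta> by (simp add: \<rho>_def)
  have e1e1: "h e1 e1 = of_real (- \<rho>)"
  proof -
    have "h e1 e1 = (cnj \<alpha> - 1) * h e1 e + (\<alpha> - 1) * h e1 w"
      using e w e1 by (subst (2) e1_def) (simp add: h_linear)
    also have "\<dots> = of_real (- \<delta>) * (\<alpha> + cnj \<alpha> - 2)"
      unfolding e1e e1w by (simp add: algebra_simps)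
    also have "\<alpha> + cnj \<alpha> - 2 = of_real (2 * (Re \<alpha> - 1))"
      by (simp add: complex_add_cnj)
    finally show ?thesis by (simp add: \<rho>_def algebra_simps)
  qed
  \<comment> \<open>The sign makes \<open>e - e'\<close> and \<open>e' - w\<close> negative, in particular not isotropic.\<close>
  define s where "s = - (1 / sqrt \<rho>)"
  have s: "s < 0" "s * (s * \<rho>) = 1" using \<rho> by (auto simp: s_def)
  define e' where "e' = complex_of_real s \<cdot>\<^sub>v e1"
  have e': "e' \<in> V" using e1 by (simp add: e'_def)
  have ee1: "h e e1 = of_real (- \<delta>)" using h_cnj[OF e1 e(1)] unfolding e1e by simp
  have we1: "h w e1 = of_real (- \<delta>)" using h_cnj[OF e1 w(1)] unfolding e1w by simp
  have e'e: "h e' e = of_real (- (s * \<delta>))" "h e e' = of_real (- (s * \<delta>))"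
    using e1 e e1e ee1 by (simp_all add: e'_def h_linear)
  have e'w: "h e' w = of_real (- (s * \<delta>))" "h w e' = of_real (- (s * \<delta>))"
    using e1 w e1w we1 by (simp_all add: e'_def h_linear)
  have e'e': "h e' e' = - 1"
  proof -
    have "h e' e' = of_real (- (s * (s * \<rho>)))" using e1 e1e1 by (simp add: e'_def h_linear)
    then show ?thesis unfolding s(2) by simp
  qed
  have s\<delta>: "s * \<delta> < 0" using s(1) \<delta> by (simp add: mult_neg_pos)
  have nz: "complex_of_real (- 2 + 2 * (s * \<delta>)) \<noteq> 0"
    using s\<delta> by (simp only: of_real_eq_0_iff)
  have hb: "h (e - e') (e - e') \<noteq> 0"
  proof -
    have eq: "h (e - e') (e - e') = of_real (- 2 + 2 * (s * \<delta>))"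
      using e e' e'e e'e' by (simp add: h_linear)
    show ?thesis unfolding eq by (rule nz)
  qed
  have ha: "h (e' - w) (e' - w) \<noteq> 0"
  proof -
    have eq: "h (e' - w) (e' - w) = of_real (- 2 + 2 * (s * \<delta>))"
      using w e' e'w e'e' by (simp add: h_linear)
    show ?thesis unfolding eq by (rule nz)
  qed
  have R: "reflection (e - e') *\<^sub>v e = e'" "reflection (e' - w) *\<^sub>v e' = w"
    using e w e' e'e e'w e'e' ha hb by (auto intro!: reflection_swaps)
  show thesis
  proof (rule that[of "e' - w" "e - e'" f "complex_of_real (sqrt \<delta>)"])
    show "\<forall>A\<in>U. A *\<^sub>v e = e \<longrightarrow> A *\<^sub>v w = w \<longrightarrow>
      A *\<^sub>v (e' - w) = e' - w \<and> A *\<^sub>v (e - e') = e - e'"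
    proof (intro ballI impI)
      fix A assume A: "A \<in> U" "A *\<^sub>v e = e" "A *\<^sub>v w = w"
      have "A *\<^sub>v e1 = e1"
        unfolding e1_def using mult_linear_combination[OF A(1) e(1) w(1) A(2,3)] .
      then have "A *\<^sub>v e' = e'"
        using mult_mat_vec[OF U_carrier[OF A(1)] e1] by (simp add: e'_def)
      then show "A *\<^sub>v (e' - w) = e' - w \<and> A *\<^sub>v (e - e') = e - e'"
        using mult_diff_fixed[OF A(1)] A(2,3) e(1) w(1) e' by simp
    qed
  next
    show "w = - h w e \<cdot>\<^sub>v e + complex_of_real (sqrt \<delta>) \<cdot>\<^sub>v f"
      using w_eq unfolding \<alpha>_def .
  qed (use e w e' ha hb f fe R in auto)
qed

text \<open>Here two reflections move the negative vector \<open>e\<close> to \<open>g e\<close>, which leaves an isometry fixing \<open>e\<close>. It is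
  factored by working from \<open>e\<close> on through positive definite complements, and the two reflections are
  absorbed into its first two factors because these fix the plane of \<open>e\<close> and \<open>g e\<close>.\<close>

lemma four_involutives_of_expanding:
  assumes g: "g \<in> U" "det g \<in> {1, - 1}"
    and e: "e \<in> V" "h e e = - 1" and re: "Re (h (g *\<^sub>v e) e) < - 1"
  shows "four_involutive_product g"
proof -
  define w where "w = g *\<^sub>v e"
  have w: "w \<in> V" "h w w = - 1" "Re (h w e) < - 1"
    using g e re U_preserves[OF g(1) e(1) e(1)] by (auto simp: w_def)
  obtain a b f c where ab: "a \<in> V" "h a a \<noteq> 0" "b \<in> V" "h b b \<noteq> 0"
    and f: "f \<in> V" "h f f = 1" "h e f = 0" and w_eq: "w = - h w e \<cdot>\<^sub>v e + c \<cdot>\<^sub>v f"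
    and R: "reflection a *\<^sub>v (reflection b *\<^sub>v e) = w"
    and fixes_ab: "\<forall>A\<in>U. A *\<^sub>v e = e \<longrightarrow> A *\<^sub>v w = w \<longrightarrow> A *\<^sub>v a = a \<and> A *\<^sub>v b = b"
    by (rule ex_hyperbolic_factor[OF e w])
  let ?A = "reflection a" and ?B = "reflection b"
  have A: "?A \<in> involutives" and B: "?B \<in> involutives" using reflection_involutives ab by auto
  note AU = involutives_U[OF A] and BU = involutives_U[OF B]
  let ?g = "?B * (?A * g)"
  have gU: "?g \<in> U" using AU BU g U_mult by simp
  have det: "det ?g \<in> {1, - 1}"
    using det_involutives[OF A] det_involutives[OF B] g AU BU
    by (auto simp: det_U_mult U_mult)
  have ge: "?g *\<^sub>v e = e"
  proof -
    have "?g *\<^sub>v e = ?B *\<^sub>v (?A *\<^sub>v w)"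
      using AU BU g e by (simp add: U_mult_mult_vec U_mult w_def)
    also have "\<dots> = e"
      unfolding R[symmetric] using involutives_cancel_vec A B BU e(1) by simp
    finally show ?thesis .
  qed
  have "orthogonal_list ([e] @ [f])" "length [e] < N" "e \<in> set [e]" "Re (h e e) < 0"
    using e f dim by (auto simp: orthogonal_list_def)
  from four_involutives_fixing_negative[OF this f(2) gU det] ge
  obtain P Q R S where PQRS: "P \<in> involutives" "Q \<in> involutives" "R \<in> involutives" "S \<in> involutives"
    and g_eq: "?g = P * (Q * (R * S))"
    and PQ: "P *\<^sub>v e = e" "Q *\<^sub>v e = e" "P *\<^sub>v f = f" "Q *\<^sub>v f = f"
    by auto
  note PU = involutives_U[OF PQRS(1)] and QU = involutives_U[OF PQRS(2)]
    and RU = involutives_U[OF PQRS(3)] and SU = involutives_U[OF PQRS(4)]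
  have "P *\<^sub>v w = w" "Q *\<^sub>v w = w"
    using mult_linear_combination[OF PU e(1) f(1) PQ(1,3)] mult_linear_combination[OF QU e(1) f(1) PQ(2,4)]
      w_eq by metis+
  then have comm: "P * ?A = ?A * P" "P * ?B = ?B * P" "Q * ?B = ?B * Q"
    using reflection_commute ab PU QU fixes_ab PQ by auto
  have "g = ?A * (?B * ?g)"
    using AU BU g A B by (simp add: U_mult involutives_cancel)
  also have "\<dots> = ?A * (?B * (P * (Q * (R * S))))" unfolding g_eq ..
  also have "?B * (P * (Q * (R * S))) = (?B * P) * (Q * (R * S))"
    using BU PU QU RU SU by (intro U_assoc[symmetric] U_mult)
  also have "\<dots> = P * ((?B * Q) * (R * S))"
    unfolding comm(2)[symmetric] using BU PU QU RU SU by (simp add: U_assoc U_mult)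
  also have "?A * (P * ((?B * Q) * (R * S))) = (?A * P) * ((?B * Q) * (R * S))"
    using AU BU PU QU RU SU by (intro U_assoc[symmetric] U_mult)
  finally have "g = (?A * P) * ((?B * Q) * (R * S))" .
  moreover have "?A * P \<in> involutives" "?B * Q \<in> involutives"
    using involutives_mult A B PQRS comm by metis+
  ultimately show ?thesis
    unfolding four_involutive_product_def using PQRS by blast
qed

text \<open>The sesquilinear form \<open>s x y = \<langle>g x, y\<rangle>\<close> would vanish on all null vectors. For \<open>e\<close> of norm
  \<open>- 1\<close> and \<open>u\<close> orthogonal to \<open>e\<close> with norm \<open>r\<^sup>2\<close>, the vectors \<open>r \<zeta> e + u\<close> with \<open>|\<zeta>| = 1\<close> are null.
  Comparing the
  coefficients of \<open>\<zeta>\<close> shows that \<open>e\<close> and its complement are orthogonal for \<open>s\<close> and that \<open>s x x = c \<langle>x, x\<rangle>\<close> on both, where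
  \<open>c = - s e e\<close>. By polarisation \<open>g\<close> is the scalar \<open>c\<close>.\<close>

lemma ex_null_vector_moved:
  assumes g: "g \<in> U" and ns: "\<And>c. g \<noteq> c \<cdot>\<^sub>m 1\<^sub>m N"
  obtains v where "v \<in> V" "h v v = 0" "h (g *\<^sub>v v) v \<noteq> 0"
proof (rule ccontr)
  assume "\<not> thesis"
  then have null: "h (g *\<^sub>v v) v = 0" if "v \<in> V" "h v v = 0" for v
    using that \<open>\<And>v. v \<in> V \<Longrightarrow> h v v = 0 \<Longrightarrow> h (g *\<^sub>v v) v \<noteq> 0 \<Longrightarrow> thesis\<close> by blast
  obtain e where e: "e \<in> V" "h e e = - 1" by (rule ex_negative_vector)
  define s where "s x y = h (g *\<^sub>v x) y" for x y
  have gV: "g *\<^sub>v x \<in> V" if "x \<in> V" for x using g that by simp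
  have s_lin: "x \<in> V \<Longrightarrow> y \<in> V \<Longrightarrow> z \<in> V \<Longrightarrow> s (x + y) z = s x z + s y z"
    "x \<in> V \<Longrightarrow> y \<in> V \<Longrightarrow> z \<in> V \<Longrightarrow> s z (x + y) = s z x + s z y"
    "x \<in> V \<Longrightarrow> z \<in> V \<Longrightarrow> s (a \<cdot>\<^sub>v x) z = a * s x z"
    "x \<in> V \<Longrightarrow> z \<in> V \<Longrightarrow> s z (a \<cdot>\<^sub>v x) = cnj a * s z x" for x y z a
    using gV U_carrier[OF g]
    by (simp_all add: s_def mult_add_distrib_mat_vec[of _ N N] mult_mat_vec[of _ N N] h_linear)
  define c where "c = - s e e"
  have on_complement: "s e u = 0 \<and> s u e = 0 \<and> s u u = c * h u u" if u: "u \<in> V" "h u e = 0" for u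
  proof (cases "u = 0\<^sub>v N")
    case True
    then have "u = 0 \<cdot>\<^sub>v u" by (intro eq_vecI) auto
    then show ?thesis using u e s_lin(3,4)[of u e 0] s_lin(3,4)[of u u 0] h_zero_left[OF u(1)] True
      by (metis complex_cnj_zero mult_zero_left mult_zero_right)
  next
    case False
    then have pos: "Re (h u u) > 0" using h_pos_if_orthogonal_to_negative[of e u] e u by simp
    define r where "r = sqrt (Re (h u u))"
    have r: "r > 0" "h u u = of_real r * of_real r"
      using pos h_self[OF u(1)] by (simp_all add: r_def of_real_mult[symmetric])
    have eu: "h e u = 0" using h_eq_0_commute u e by blast
    have key: "of_real r * of_real r * s e e + s u u + of_real r * (\<zeta> * s e u + cnj \<zeta> * s u e) = 0"
      if "\<zeta> * cnj \<zeta> = 1" for \<zeta>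
    proof -
      let ?v = "(of_real r * \<zeta>) \<cdot>\<^sub>v e + u"
      have "h ?v ?v = - (of_real r * of_real r * (\<zeta> * cnj \<zeta>)) + h u u"
        using e u eu by (simp add: h_linear)
      also have "\<dots> = 0" unfolding that r(2) by simp
      finally have "s ?v ?v = 0" using null[of ?v] e u by (simp add: s_def)
      moreover have "s ?v ?v = of_real r * of_real r * (\<zeta> * cnj \<zeta>) * s e e + s u u
          + of_real r * (\<zeta> * s e u + cnj \<zeta> * s u e)"
        using e u by (simp add: s_lin algebra_simps)
      ultimately show ?thesis unfolding that by simp
    qed
    have k1: "of_real r * of_real r * s e e + s u u + of_real r * (s e u + s u e) = 0"
      using key[of 1] by simp
    have k2: "of_real r * of_real r * s e e + s u u - of_real r * (s e u + s u e) = 0"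
      using key[of "- 1"] by (simp add: algebra_simps)
    have k3: "of_real r * of_real r * s e e + s u u + of_real r * (\<i> * (s e u - s u e)) = 0"
      using key[of \<i>] by (simp add: algebra_simps)
    have "Y = 0" if "X + Y = 0" "X - Y = 0" for X Y :: complex
      using that by (simp add: complex_eq_iff)
    from this[OF k1 k2] have "of_real r * (s e u + s u e) = 0" .
    then have 1: "s e u + s u e = 0" using r by simp
    then have 2: "of_real r * of_real r * s e e + s u u = 0" using k1 by simp
    then have "s e u - s u e = 0" using k3 r by simp
    with 1 have "s e u = 0" "s u e = 0" by auto
    moreover have "s u u = c * h u u" unfolding r(2) c_def using 2 by (simp add: add_eq_0_iff mult_ac)
    ultimately show ?thesis by blast
  qed
  define T where "T x y = s x y - c * h x y" for x y
  have T_lin: "x \<in> V \<Longrightarrow> y \<in> V \<Longrightarrow> z \<in> V \<Longrightarrow> T (x + y) z = T x z + T y z"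
    "x \<in> V \<Longrightarrow> y \<in> V \<Longrightarrow> z \<in> V \<Longrightarrow> T z (x + y) = T z x + T z y"
    "x \<in> V \<Longrightarrow> z \<in> V \<Longrightarrow> T (a \<cdot>\<^sub>v x) z = a * T x z"
    "x \<in> V \<Longrightarrow> z \<in> V \<Longrightarrow> T z (a \<cdot>\<^sub>v x) = cnj a * T z x" for x y z a
    by (simp_all add: T_def s_lin h_linear algebra_simps)
  have T0: "T x x = 0" if x: "x \<in> V" for x
  proof -
    let ?t = "- h x e"
    define u where "u = x - ?t \<cdot>\<^sub>v e"
    have u: "u \<in> V" "h u e = 0" using x e by (simp_all add: u_def h_linear)
    have eu: "h e u = 0" using h_eq_0_commute u e by blast
    have x_eq: "x = ?t \<cdot>\<^sub>v e + u" using x e by (auto simp: u_def)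
    have "T e e = 0" "T e u = 0" "T u e = 0" "T u u = 0"
      using on_complement[OF u] e u eu by (simp_all add: T_def c_def)
    then have "T (?t \<cdot>\<^sub>v e + u) (?t \<cdot>\<^sub>v e + u) = 0"
      using e(1) u(1) T_lin by (simp only: T_lin smult_carrier_vec add_carrier_vec) simp
    then show ?thesis using x_eq by simp
  qed
  have T_zero: "T x y = 0" if "x \<in> V" "y \<in> V" for x y
  proof -
    have "T x y + T y x = 0"
      using T0[of "x + y"] T0[OF that(1)] T0[OF that(2)] that by (simp add: T_lin add.commute)
    moreover have "\<i> * (T y x - T x y) = 0"
      using T0[of "x + \<i> \<cdot>\<^sub>v y"] T0[OF that(1)] T0[OF that(2)] that
      by (simp add: T_lin algebra_simps)
    ultimately show ?thesis by simp
  qed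
  have "g = c \<cdot>\<^sub>m 1\<^sub>m N"
  proof (rule mat_eqI_mult_vec[of _ N N])
    fix x assume x: "x \<in> V"
    have "g *\<^sub>v x - c \<cdot>\<^sub>v x = 0\<^sub>v N"
      using T_zero x gV by (intro nondegenerate) (auto simp: T_def s_def h_linear)
    then have "g *\<^sub>v x = c \<cdot>\<^sub>v x"
      by (intro vec_diff_eq_0D[OF gV[OF x]]) (simp only: smult_carrier_vec x)
    also have "\<dots> = (c \<cdot>\<^sub>m 1\<^sub>m N) *\<^sub>v x" using x by (intro eq_vecI) auto
    finally show "g *\<^sub>v x = (c \<cdot>\<^sub>m 1\<^sub>m N) *\<^sub>v x" .
  qed (use U_carrier[OF g] in auto)
  with ns show False by blast
qed

text \<open>On negative vectors \<open>x\<close> close to \<open>v\<close> the norm of \<open>x\<close> tends to \<open>0\<close> while \<open>\<langle>g x, x\<rangle>\<close> tends to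
  \<open>\<langle>g v, v\<rangle>\<close>, so that the quotient of their real parts is unbounded.\<close>

lemma ex_expanding_near_null:
  assumes g: "g \<in> U" and v: "v \<in> V" "h v v = 0" and re: "Re (h (g *\<^sub>v v) v) \<noteq> 0"
  obtains x where "x \<in> V" "h x x = - 1" "\<bar>Re (h (g *\<^sub>v x) x)\<bar> > 1"
proof -
  obtain e0 where e0: "e0 \<in> V" "h e0 e0 = - 1" by (rule ex_negative_vector)
  obtain e where e: "e \<in> V" "h e e = - 1" "Re (h v e) \<le> 0"
  proof (cases "Re (h v e0) \<le> 0")
    case False
    have "h ((- 1) \<cdot>\<^sub>v e0) ((- 1) \<cdot>\<^sub>v e0) = - 1" "h v ((- 1) \<cdot>\<^sub>v e0) = - h v e0"
      using e0 v by (simp_all only: h_linear smult_carrier_vec) auto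
    then show ?thesis using that[of "(- 1) \<cdot>\<^sub>v e0"] e0 False by simp
  qed (use e0 that in blast)
  let ?x = "\<lambda>t :: real. v + of_real t \<cdot>\<^sub>v e"
  define z B C where "z = h (g *\<^sub>v v) v" and "B = h (g *\<^sub>v v) e + h (g *\<^sub>v e) v" and "C = h (g *\<^sub>v e) e"
  have x: "?x t \<in> V" for t using v e by simp
  have gx: "h (g *\<^sub>v ?x t) (?x t) = z + of_real t * B + of_real t * of_real t * C" for t
    using v e g U_carrier[OF g]
    by (simp add: mult_add_distrib_mat_vec[of _ N N] mult_mat_vec[of _ N N] h_linear z_def B_def C_def algebra_simps)
  have hx: "Re (h (?x t) (?x t)) = 2 * t * Re (h v e) - t * t" for t
  proof -
    have "Re (h e v) = Re (h v e)" unfolding h_cnj[OF v(1) e(1), symmetric] by simp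
    then show ?thesis using v e by (simp add: h_linear algebra_simps)
  qed
  have "((\<lambda>t. \<bar>Re (z + of_real t * B + of_real t * of_real t * C)\<bar> + (2 * t * Re (h v e) - t * t))
      \<longlongrightarrow> \<bar>Re (z + of_real 0 * B + of_real 0 * of_real 0 * C)\<bar> + (2 * 0 * Re (h v e) - 0 * 0)) (at_right 0)"
    by (intro tendsto_intros)
  moreover have "\<bar>Re (z + of_real 0 * B + of_real 0 * of_real 0 * C)\<bar> + (2 * 0 * Re (h v e) - 0 * 0) > 0"
    using re by (simp add: z_def)
  ultimately have "eventually (\<lambda>t. 0 < \<bar>Re (z + of_real t * B + of_real t * of_real t * C)\<bar> + (2 * t * Re (h v e) - t * t)) (at_right 0)"
    by (rule order_tendstoD(1))
  then have "eventually (\<lambda>t. t > 0 \<and> 0 < \<bar>Re (h (g *\<^sub>v ?x t) (?x t))\<bar> + Re (h (?x t) (?x t))) (at_right 0)"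
    unfolding gx hx by (intro eventually_conj eventually_at_right_less)
  then obtain t where t: "t > 0" "0 < \<bar>Re (h (g *\<^sub>v ?x t) (?x t))\<bar> + Re (h (?x t) (?x t))"
    using eventually_happens'[OF trivial_limit_at_right_real] by blast
  define y where "y = ?x t"
  have y: "y \<in> V" using x by (simp add: y_def)
  define q where "q = - Re (h y y)"
  have "t * Re (h v e) \<le> 0" using t(1) e(3) by (simp add: mult_nonneg_nonpos)
  moreover have "t * t > 0" using t(1) by simp
  ultimately have q: "q > 0" unfolding q_def y_def hx by linarith
  have yq: "\<bar>Re (h (g *\<^sub>v y) y)\<bar> > q" using t(2) unfolding q_def y_def by linarith
  define s where "s = 1 / sqrt q"
  have s: "s * (s * q) = 1" "s * s = 1 / q" using q by (simp_all add: s_def)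
  have "h y y = of_real (- q)" using h_self[OF y] by (simp add: q_def)
  then have "h (of_real s \<cdot>\<^sub>v y) (of_real s \<cdot>\<^sub>v y) = of_real (- (s * (s * q)))"
    using y by (simp add: h_linear)
  then have 1: "h (of_real s \<cdot>\<^sub>v y) (of_real s \<cdot>\<^sub>v y) = - 1" unfolding s(1) by simp
  have "h (g *\<^sub>v (of_real s \<cdot>\<^sub>v y)) (of_real s \<cdot>\<^sub>v y) = of_real (s * s) * h (g *\<^sub>v y) y"
    using y g mult_mat_vec[OF U_carrier[OF g] y] by (simp add: h_linear)
  then have "Re (h (g *\<^sub>v (of_real s \<cdot>\<^sub>v y)) (of_real s \<cdot>\<^sub>v y)) = s * s * Re (h (g *\<^sub>v y) y)"
    by simp
  then have "Re (h (g *\<^sub>v (of_real s \<cdot>\<^sub>v y)) (of_real s \<cdot>\<^sub>v y)) = Re (h (g *\<^sub>v y) y) / q"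
    unfolding s(2) by simp
  moreover have "\<bar>Re (h (g *\<^sub>v y) y) / q\<bar> > 1" using yq q by (simp add: abs_divide)
  ultimately show thesis using that[of "of_real s \<cdot>\<^sub>v y"] 1 y by simp
qed

lemma h_smult_mat:
  assumes "g \<in> U" "x \<in> V" "y \<in> V"
  shows "h ((c \<cdot>\<^sub>m g) *\<^sub>v x) y = c * h (g *\<^sub>v x) y"
proof -
  have "(c \<cdot>\<^sub>m g) *\<^sub>v x = c \<cdot>\<^sub>v (g *\<^sub>v x)"
    using smult_mat_mult_vec[OF U_carrier[OF assms(1)] assms(2)] .
  then show ?thesis using assms by (simp add: h_linear)
qed

text \<open>Two unit multiples \<open>c\<^sub>0 g\<close> and \<open>c\<^sub>1 g\<close> have determinant \<open>1\<close> and \<open>- 1\<close>, where \<open>c\<^sub>1 / c\<^sub>0\<close> is an \<open>N\<close>-th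
  root of \<open>- 1\<close> that is not real since \<open>N \<ge> 2\<close>. Hence \<open>Re (c \<langle>g v, v\<rangle>)\<close> is nonzero for one
  of them, whichever null vector \<open>v\<close> with \<open>\<langle>g v, v\<rangle> \<noteq> 0\<close> is used.\<close>

theorem scalar_multiple_four_involutives:
  assumes g: "g \<in> U" and ns: "\<And>c. g \<noteq> c \<cdot>\<^sub>m 1\<^sub>m N"
  shows "\<exists>c. cmod c = 1 \<and> four_involutive_product (c \<cdot>\<^sub>m g)"
proof -
  obtain v where v: "v \<in> V" "h v v = 0" "h (g *\<^sub>v v) v \<noteq> 0"
    using ex_null_vector_moved[OF g ns] by blast
  define z where "z = h (g *\<^sub>v v) v"
  have N: "real N > 0" using dim by simp
  \<comment> \<open>The argument of \<open>c\<^sub>0\<^sup>N\<close> cancels that of the determinant, which has modulus one.\<close>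
  define c0 where "c0 = cis (- Arg (det g) / N)"
  define c1 where "c1 = c0 * cis (pi / N)"
  have det_g: "det g = cis (Arg (det g))"
  proof -
    have "det g \<noteq> 0" using U_det_unit[OF g] by auto
    then show ?thesis using cis_Arg[of "det g"] U_det_unit[OF g] by (simp add: sgn_div_norm)
  qed
  have det: "det (c \<cdot>\<^sub>m g) = c ^ N * det g" for c
    using U_carrier[OF g] by simp
  have c0: "cmod c0 = 1" "c0 ^ N * det g = 1"
  proof -
    have "c0 ^ N = cis (- Arg (det g))" using N by (simp add: c0_def Complex.DeMoivre)
    then have "c0 ^ N * det g = cis (- Arg (det g)) * cis (Arg (det g))" using det_g by simp
    then show "c0 ^ N * det g = 1" by (simp add: cis_mult)
  qed (simp add: c0_def)
  have c1: "cmod c1 = 1" "c1 ^ N * det g = - 1"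
  proof -
    have "cis (pi / N) ^ N = - 1" using N by (simp add: Complex.DeMoivre)
    moreover have "c1 ^ N * det g = (c0 ^ N * det g) * cis (pi / N) ^ N"
      by (simp add: c1_def power_mult_distrib)
    ultimately show "c1 ^ N * det g = - 1" using c0(2) by simp
  qed (simp add: c1_def c0_def norm_mult)
  have "Re (c0 * z) \<noteq> 0 \<or> Re (c1 * z) \<noteq> 0"
  proof (rule ccontr)
    assume "\<not> (Re (c0 * z) \<noteq> 0 \<or> Re (c1 * z) \<noteq> 0)"
    then have 0: "Re (c0 * z) = 0" "Re (c0 * z * cis (pi / N)) = 0"
      by (auto simp: c1_def mult_ac)
    have "sin (pi / N) > 0"
      using dim by (intro sin_gt_zero) (auto simp: field_simps)
    moreover have "Im (c0 * z) * sin (pi / N) = 0" using 0 by simp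
    ultimately have "Im (c0 * z) = 0" by simp
    then have "c0 * z = 0" using 0 by (simp add: complex_eq_iff)
    then show False using v(3) c0 by (auto simp: z_def)
  qed
  moreover have "det (c0 \<cdot>\<^sub>m g) \<in> {1, - 1}" "det (c1 \<cdot>\<^sub>m g) \<in> {1, - 1}"
    unfolding det c0(2) c1(2) by simp_all
  ultimately obtain c where c: "cmod c = 1" "det (c \<cdot>\<^sub>m g) \<in> {1, - 1}" "Re (c * z) \<noteq> 0"
    using c0(1) c1(1) by blast
  have cg: "c \<cdot>\<^sub>m g \<in> U" using U_smult g c by simp
  have "Re (h ((c \<cdot>\<^sub>m g) *\<^sub>v v) v) \<noteq> 0" using c(3) h_smult_mat[OF g v(1) v(1)] by (simp add: z_def)
  then obtain x where x: "x \<in> V" "h x x = - 1" "\<bar>Re (h ((c \<cdot>\<^sub>m g) *\<^sub>v x) x)\<bar> > 1"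
    using ex_expanding_near_null[OF cg v(1,2)] by blast
  show ?thesis
  proof (cases "Re (h ((c \<cdot>\<^sub>m g) *\<^sub>v x) x) < - 1")
    case True
    then show ?thesis using four_involutives_of_expanding[OF cg c(2) x(1,2)] c(1) by blast
  next
    case False
    have "det ((- c) \<cdot>\<^sub>m g) = (- 1) ^ N * det (c \<cdot>\<^sub>m g)" unfolding det by (simp add: power_mult_distrib[symmetric])
    then have "det ((- c) \<cdot>\<^sub>m g) \<in> {1, - 1}" using c(2) by (cases "even N") auto
    moreover have "Re (h (((- c) \<cdot>\<^sub>m g) *\<^sub>v x) x) < - 1"
      using False x(3) h_smult_mat[OF g x(1) x(1)] by simp
    ultimately show ?thesis
      using four_involutives_of_expanding[OF U_smult[OF g, of "- c"] _ x(1,2)] c(1)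
      by (metis norm_minus_cancel)
  qed
qed

section \<open>An isometry that is not a product of three involutive ones\<close>

text \<open>The isometry \<open>r = I\<^sub>1 I\<^sub>2\<close> equals \<open>c g I\<^sub>3\<close> with \<open>g\<close> the complex reflection, so it acts as \<open>c I\<^sub>3\<close> on
  \<open>K = {p, I\<^sub>3 p}\<^sup>\<bottom>\<close>. Since \<open>K\<close> is invariant under \<open>I\<^sub>3\<close>, the square of \<open>r\<close> is the scalar \<open>c\<^sup>2\<close> on \<open>K\<close>. As
  \<open>I\<^sub>1\<close> conjugates \<open>r\<close> to its inverse, the square of \<open>r\<close> is \<open>c\<^sup>-\<^sup>2\<close> on \<open>I\<^sub>1 K\<close>. The two scalars differ by
  \<open>c\<^sup>4 \<noteq> 1\<close>, and eigenspaces of an isometry for different unit eigenvalues are orthogonal, so \<open>K\<close> and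
  \<open>I\<^sub>1 K\<close> are orthogonal. Both are positive definite of dimension at least \<open>N - 2\<close>, which for \<open>N \<ge> 4\<close>
  leaves no room for a negative direction.

  In place of the dimension count, a single vector \<open>y \<in> I\<^sub>1 K\<close> is chosen orthogonal to the component \<open>q\<close>
  of \<open>I\<^sub>3 p\<close> in \<open>p\<^sup>\<bottom>\<close>. Its own component \<open>z\<close> in \<open>p\<^sup>\<bottom>\<close> lies in \<open>K\<close> and is therefore orthogonal to \<open>y\<close>, which
  forces \<open>z = 0\<close>. Then \<open>y\<close> is a multiple of the negative vector \<open>p\<close>, although \<open>I\<^sub>1 K\<close> is positive
  definite.\<close>

lemma creflection_not_three_involutives:
  assumes N: "N \<ge> 4" and p: "p \<in> V" "Re (h p p) < 0"
    and I: "I1 \<in> involutives" "I2 \<in> involutives" "I3 \<in> involutives"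
    and eq: "c \<cdot>\<^sub>m creflection p \<mu> = I1 * (I2 * I3)" and c4: "c ^ 4 \<noteq> 1" "cmod c = 1"
  shows False
proof -
  note I1 = involutives_U[OF I(1)] and I2 = involutives_U[OF I(2)] and I3 = involutives_U[OF I(3)]
  have hpp: "h p p \<noteq> 0" using p by auto
  let ?p' = "I3 *\<^sub>v p"
  have p': "?p' \<in> V" using I3 p by simp
  define q where "q = ?p' - (h ?p' p / h p p) \<cdot>\<^sub>v p"
  have q: "q \<in> V" using p p' by (simp add: q_def)
  have r: "I1 *\<^sub>v (I2 *\<^sub>v x) = c \<cdot>\<^sub>v (I3 *\<^sub>v x) \<and> h (I3 *\<^sub>v x) p = 0 \<and> h (I3 *\<^sub>v x) ?p' = 0"
    if x: "x \<in> V" "h x p = 0" "h x ?p' = 0" for x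
  proof -
    have x': "I3 *\<^sub>v x \<in> V" using I3 x by simp
    have orth: "h (I3 *\<^sub>v x) p = 0" "h (I3 *\<^sub>v x) ?p' = 0"
      using involutives_adjoint[OF I(3) x(1) p(1)] x U_preserves[OF I3 x(1) p(1)] by auto
    have "(c \<cdot>\<^sub>m creflection p \<mu>) *\<^sub>v (I3 *\<^sub>v x) = c \<cdot>\<^sub>v (creflection p \<mu> *\<^sub>v (I3 *\<^sub>v x))"
      using x' by (intro smult_mat_mult_vec[of _ N N]) auto
    also have "\<dots> = c \<cdot>\<^sub>v (I3 *\<^sub>v x)"
      using creflection_orthogonal[OF p(1) x' orth(1)] by simp
    finally have "c \<cdot>\<^sub>v (I3 *\<^sub>v x) = (I1 * (I2 * I3)) *\<^sub>v (I3 *\<^sub>v x)" using eq by simp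
    also have "\<dots> = I1 *\<^sub>v (I2 *\<^sub>v x)"
      using I1 I2 I3 x involutives_cancel_vec[OF I(3) x(1)] by (simp add: U_mult_mult_vec U_mult)
    finally show ?thesis using orth by simp
  qed
  \<comment> \<open>The square of \<open>I\<^sub>1 I\<^sub>2\<close> is the scalar \<open>c\<^sup>2\<close> on \<open>K\<close>.\<close>
  have r2: "I1 *\<^sub>v (I2 *\<^sub>v (I1 *\<^sub>v (I2 *\<^sub>v x))) = (c * c) \<cdot>\<^sub>v x"
    if x: "x \<in> V" "h x p = 0" "h x ?p' = 0" for x
  proof -
    have x': "I3 *\<^sub>v x \<in> V" using I3 x by simp
    have "I1 *\<^sub>v (I2 *\<^sub>v (c \<cdot>\<^sub>v (I3 *\<^sub>v x))) = c \<cdot>\<^sub>v (I1 *\<^sub>v (I2 *\<^sub>v (I3 *\<^sub>v x)))"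
      using mult_mat_vec[OF U_carrier[OF I2] x'] mult_mat_vec[OF U_carrier[OF I1], of "I2 *\<^sub>v (I3 *\<^sub>v x)"] I2 x'
      by simp
    also have "I1 *\<^sub>v (I2 *\<^sub>v (I3 *\<^sub>v x)) = c \<cdot>\<^sub>v (I3 *\<^sub>v (I3 *\<^sub>v x))"
      using r[OF x'] r[OF x] by simp
    finally show ?thesis
      using r[OF x] involutives_cancel_vec[OF I(3) x(1)] by (simp add: smult_smult_assoc)
  qed
  \<comment> \<open>The subspaces \<open>K\<close> and \<open>I\<^sub>1 K\<close> are orthogonal.\<close>
  have orth: "h x (I1 *\<^sub>v y) = 0"
    if x: "x \<in> V" "h x p = 0" "h x ?p' = 0" and y: "y \<in> V" "h y p = 0" "h y ?p' = 0" for x y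
  proof -
    have V: "I1 *\<^sub>v y \<in> V" using I1 y by simp
    note adj = involutives_adjoint[OF I(1)] involutives_adjoint[OF I(2)]
    have "c * c * h x (I1 *\<^sub>v y) = h (I1 *\<^sub>v (I2 *\<^sub>v (I1 *\<^sub>v (I2 *\<^sub>v x)))) (I1 *\<^sub>v y)"
      using r2[OF x] x V by (simp add: h_linear)
    also have "\<dots> = h x (I2 *\<^sub>v (I1 *\<^sub>v (I2 *\<^sub>v y)))"
      using adj x y I1 I2 involutives_cancel_vec[OF I(1) y(1)] by simp
    also have "I2 *\<^sub>v (I1 *\<^sub>v (I2 *\<^sub>v y)) = I1 *\<^sub>v ((c * c) \<cdot>\<^sub>v y)"
      using involutives_cancel_vec[OF I(1), of "I2 *\<^sub>v (I1 *\<^sub>v (I2 *\<^sub>v y))"] r2[OF y] I1 I2 y by simp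
    also have "\<dots> = (c * c) \<cdot>\<^sub>v (I1 *\<^sub>v y)"
      using mult_mat_vec[OF U_carrier[OF I1] y(1)] .
    also have "h x \<dots> = cnj (c * c) * h x (I1 *\<^sub>v y)" using h_smult_right[OF x(1) V] .
    finally have "(c * c - cnj (c * c)) * h x (I1 *\<^sub>v y) = 0" by (simp add: algebra_simps)
    moreover have "c * c - cnj (c * c) \<noteq> 0"
    proof
      assume "c * c - cnj (c * c) = 0"
      then have sq: "c * c = cnj c * cnj c" by simp
      have "c ^ 4 = c * c * (c * c)" by (simp add: power4_eq_xxxx mult.assoc)
      also have "\<dots> = c * c * (cnj c * cnj c)" by (rule arg_cong[OF sq])
      also have "\<dots> = (c * cnj c) * (c * cnj c)" by (simp add: mult_ac)
      also have "c * cnj c = 1" using complex_norm_square[of c] c4(2) by simp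
      finally show False using c4(1) by simp
    qed
    ultimately show ?thesis by simp
  qed
  \<comment> \<open>Three conditions on a vector in dimension at least four; the last one makes \<open>I\<^sub>1 x\<close> orthogonal to \<open>q\<close>.\<close>
  obtain x where x: "x \<in> V" "x \<noteq> 0\<^sub>v N" "h x p = 0" "h x ?p' = 0" "h x (I1 *\<^sub>v q) = 0"
  proof -
    have "set [p, ?p', I1 *\<^sub>v q] \<subseteq> V" "length [p, ?p', I1 *\<^sub>v q] < N" using p p' q I1 N by auto
    then obtain x where "x \<in> V" "x \<noteq> 0\<^sub>v N" and 0: "\<And>f. f \<in> set [p, ?p', I1 *\<^sub>v q] \<Longrightarrow> h x f = 0"
      using ex_orthogonal_vector by blast
    moreover have "h x p = 0" "h x ?p' = 0" "h x (I1 *\<^sub>v q) = 0" by (rule 0, simp)+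
    ultimately show thesis using that by blast
  qed
  let ?y = "I1 *\<^sub>v x"
  have y: "?y \<in> V" using I1 x by simp
  have yq: "h ?y q = 0" using involutives_adjoint[OF I(1) x(1) q] x(5) by simp
  define t where "t = h ?y p / h p p"
  define z where "z = ?y - t \<cdot>\<^sub>v p"
  have z: "z \<in> V" "h z p = 0" using y p hpp by (simp_all add: z_def t_def h_linear)
  have pq: "h p q = 0"
  proof -
    have "h q p = 0" using p p' hpp by (simp add: q_def h_linear)
    then show ?thesis using h_eq_0_commute p q by blast
  qed
  have "h z q = 0" using y p q yq pq by (simp add: z_def h_linear)
  moreover have "h z q = h z ?p'" using z p p' by (simp add: q_def h_linear)
  ultimately have zp': "h z ?p' = 0" by simp
  have "h z ?y = 0" using orth[OF z zp' x(1,3,4)] .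
  then have "h z z = 0" using z y p by (subst (2) z_def) (simp add: h_linear)
  then have "z = 0\<^sub>v N" using h_pos_if_orthogonal_to_negative[OF p z] by force
  then have "?y = t \<cdot>\<^sub>v p"
    unfolding z_def by (intro vec_diff_eq_0D[OF y]) (simp only: smult_carrier_vec p(1))
  then have "h ?y ?y = t * cnj t * h p p" using p by (simp add: h_linear mult.assoc)
  then have "Re (h ?y ?y) = (cmod t)\<^sup>2 * Re (h p p)" by (simp add: complex_norm_square[symmetric])
  then have "Re (h ?y ?y) \<le> 0" using p(2) by (simp add: mult_nonneg_nonpos)
  moreover have "Re (h ?y ?y) > 0"
    using U_preserves[OF I1 x(1) x(1)] h_pos_if_orthogonal_to_negative[OF p x(1,3,2)] by simp
  ultimately show False by simp
qed

text \<open>The complex reflection has determinant \<open>\<mu>\<close>, its multiplier. If a multiple by \<open>c\<close> is a product of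
  involutive isometries, then \<open>c\<^sup>N \<mu> = \<plusminus> 1\<close>, hence \<open>(c\<^sup>4)\<^sup>N \<mu>\<^sup>4 = 1\<close>. Any \<open>\<mu>\<close> with \<open>\<mu>\<^sup>4 \<noteq> 1\<close> therefore
  excludes \<open>c\<^sup>4 = 1\<close>.\<close>

theorem ex_not_scalar_multiple_three_involutives:
  assumes N: "N \<ge> 4"
  obtains g where "g \<in> U"
    "\<And>c I1 I2 I3. cmod c = 1 \<Longrightarrow> I1 \<in> involutives \<Longrightarrow> I2 \<in> involutives \<Longrightarrow> I3 \<in> involutives \<Longrightarrow>
      c \<cdot>\<^sub>m g \<noteq> I1 * (I2 * I3)"
proof -
  obtain bs i0 where bs: "orthogonal_frame bs" and i0: "i0 < N" and neg: "Re (h (bs ! i0) (bs ! i0)) < 0"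
    using ex_signature_frame by blast
  let ?p = "bs ! i0" and ?\<mu> = "cis (pi / 4)"
  have p: "?p \<in> V" "h ?p ?p \<noteq> 0" using frame_carrier[OF bs i0] frame_nonisotropic[OF bs i0] .
  let ?g = "creflection ?p ?\<mu>"
  have g: "?g \<in> U" using U_creflection[OF p] by simp
  have "det ?g = (\<Prod>i<N. if i = i0 then ?\<mu> else 1)"
  proof (rule frame_eigen_det[OF bs])
    fix i assume i: "i < N"
    show "?g *\<^sub>v bs ! i = (if i = i0 then ?\<mu> else 1) \<cdot>\<^sub>v bs ! i"
      using creflection_self[OF p] creflection_orthogonal[OF p(1) frame_carrier[OF bs i]]
        frame_orthogonal[OF bs i i0] by simp
  qed simp
  also have "\<dots> = ?\<mu>" using i0 by simp
  finally have det: "det ?g = ?\<mu>" .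
  have \<mu>4: "?\<mu> ^ 4 = - 1" by (simp add: Complex.DeMoivre)
  show thesis
  proof (rule that[OF g])
    fix c I1 I2 I3
    assume c: "cmod c = 1" and I: "I1 \<in> involutives" "I2 \<in> involutives" "I3 \<in> involutives"
    show "c \<cdot>\<^sub>m ?g \<noteq> I1 * (I2 * I3)"
    proof
      assume eq: "c \<cdot>\<^sub>m ?g = I1 * (I2 * I3)"
      have "det (c \<cdot>\<^sub>m ?g) = c ^ N * ?\<mu>"
        using det carrier_matD(2)[OF U_carrier[OF g]] by simp
      moreover have "det (I1 * (I2 * I3)) \<in> {1, - 1}"
        using det_involutives[OF I(1)] det_involutives[OF I(2)] det_involutives[OF I(3)] I
        by (auto simp: det_U_mult U_mult involutives_U)
      ultimately have "(c ^ N * ?\<mu>) ^ 4 = 1" using eq by auto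
      then have "(c ^ 4) ^ N * ?\<mu> ^ 4 = 1"
        by (simp add: power_mult_distrib power_mult[symmetric] mult.commute)
      then have "c ^ 4 \<noteq> 1" unfolding \<mu>4 by auto
      then show False using creflection_not_three_involutives[OF N p(1) neg I eq _ c] by blast
    qed
  qed
qed

abbreviation PU where "PU \<equiv> projective_unitary_group N h"

section \<open>The projective unitary group\<close>

lemma unitary_group_simps [simp]:
  "monoid.mult (unitary_group N h) = (*)" "one (unitary_group N h) = 1\<^sub>m N"
  by (simp_all add: unitary_group_def)

lemma group_unitary_group: "group (unitary_group N h)"
proof (rule groupI)
  fix A assume "A \<in> U"
  then show "\<exists>B\<in>U. B \<otimes>\<^bsub>unitary_group N h\<^esub> A = \<one>\<^bsub>unitary_group N h\<^esub>"
    using U_inverse by (metis unitary_group_simps)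
qed (simp_all add: U_mult U_one U_assoc U_one_left)

lemma unit_scalars_iff: "A \<in> unit_scalars N \<longleftrightarrow> (\<exists>c. cmod c = 1 \<and> A = c \<cdot>\<^sub>m 1\<^sub>m N)"
proof
  assume "\<exists>c. cmod c = 1 \<and> A = c \<cdot>\<^sub>m 1\<^sub>m N"
  then obtain c where c: "cmod c = 1" "A = c \<cdot>\<^sub>m 1\<^sub>m N" by blast
  then have "cis (Arg c) = c" using cis_Arg[of c] by (force simp: sgn_div_norm)
  then have "A = cis (Arg c) \<cdot>\<^sub>m 1\<^sub>m N" using c by simp
  then show "A \<in> unit_scalars N" unfolding unit_scalars_def by blast
next
  assume "A \<in> unit_scalars N"
  then obtain \<theta> where "A = cis \<theta> \<cdot>\<^sub>m 1\<^sub>m N" unfolding unit_scalars_def by blast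
  then show "\<exists>c. cmod c = 1 \<and> A = c \<cdot>\<^sub>m 1\<^sub>m N" by (intro exI[of _ "cis \<theta>"]) simp
qed

lemma unit_scalars_image: "unit_scalars N = (\<lambda>c. c \<cdot>\<^sub>m 1\<^sub>m N) ` {c. cmod c = 1}"
  by (auto simp: unit_scalars_iff)

lemma scalar_mult_mat:
  assumes "A \<in> U"
  shows "(c \<cdot>\<^sub>m 1\<^sub>m N) * A = c \<cdot>\<^sub>m A" "A * (c \<cdot>\<^sub>m 1\<^sub>m N) = c \<cdot>\<^sub>m A"
  using U_carrier[OF assms] by (simp_all add: mult_smult_assoc_mat[of _ N N _ N] mult_smult_distrib[of _ N N _ N])

definition proj_class :: "complex mat \<Rightarrow> complex mat set" where
  "proj_class A = r_coset (unitary_group N h) (unit_scalars N) A"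

lemma proj_class_eq:
  assumes "A \<in> U"
  shows "proj_class A = {c \<cdot>\<^sub>m A |c. cmod c = 1}"
  unfolding proj_class_def r_coset_def unitary_group_simps unit_scalars_image
  by (auto simp: scalar_mult_mat[OF assms])

lemma unit_scalars_normal: "unit_scalars N \<lhd> unitary_group N h"
proof (rule group.normalI[OF group_unitary_group])
  interpret G: group "unitary_group N h" by (rule group_unitary_group)
  show "subgroup (unit_scalars N) (unitary_group N h)"
  proof (rule G.subgroupI)
    show sub: "unit_scalars N \<subseteq> U"
      using U_smult[OF U_one] by (auto simp: unit_scalars_iff)
    show "unit_scalars N \<noteq> {}" using unit_scalars_iff[of "1 \<cdot>\<^sub>m 1\<^sub>m N"] by force
    fix A assume A: "A \<in> unit_scalars N"
    then obtain c where c: "cmod c = 1" "A = c \<cdot>\<^sub>m 1\<^sub>m N" unfolding unit_scalars_iff by blast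
    let ?B = "inverse c \<cdot>\<^sub>m 1\<^sub>m N"
    have B: "?B \<in> unit_scalars N" using c unfolding unit_scalars_iff by (metis inverse_1 norm_inverse)
    have c0: "c \<noteq> 0" using c by auto
    have "?B * A = 1\<^sub>m N"
      using scalar_mult_mat(1)[of A "inverse c"] sub A c0 by (auto simp: c(2) smult_smult_mat)
    then have "inv\<^bsub>unitary_group N h\<^esub> A = ?B"
      using G.inv_equality[of ?B A] A B sub by auto
    then show "inv\<^bsub>unitary_group N h\<^esub> A \<in> unit_scalars N" using B by simp
    fix B assume B: "B \<in> unit_scalars N"
    then obtain d where d: "cmod d = 1" "B = d \<cdot>\<^sub>m 1\<^sub>m N" unfolding unit_scalars_iff by blast
    have "A * B = (c * d) \<cdot>\<^sub>m 1\<^sub>m N"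
      using scalar_mult_mat(1)[of B c] sub B c(2) d(2) by (auto simp: smult_smult_mat)
    then show "A \<otimes>\<^bsub>unitary_group N h\<^esub> B \<in> unit_scalars N"
      using c d unfolding unit_scalars_iff by (intro exI[of _ "c * d"]) (simp add: norm_mult)
  qed
  show "\<forall>A\<in>U. r_coset (unitary_group N h) (unit_scalars N) A = l_coset (unitary_group N h) A (unit_scalars N)"
    unfolding r_coset_def l_coset_def unitary_group_simps unit_scalars_image
    by (simp add: scalar_mult_mat)
qed

lemma PU_carrier: "carrier PU = proj_class ` U"
  unfolding projective_unitary_group_def proj_class_def by (rule carrier_FactGroup)

lemma proj_class_one: "proj_class (1\<^sub>m N) = \<one>\<^bsub>PU\<^esub>"
  unfolding proj_class_eq[OF U_one] projective_unitary_group_def using unit_scalars_iff by auto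

lemma proj_class_mult: "A \<in> U \<Longrightarrow> B \<in> U \<Longrightarrow> proj_class (A * B) = proj_class A \<otimes>\<^bsub>PU\<^esub> proj_class B"
  using normal.rcos_sum[OF unit_scalars_normal, of A B]
  by (simp add: proj_class_def projective_unitary_group_def)

lemma proj_class_eq_iff:
  assumes A: "A \<in> U" and B: "B \<in> U"
  shows "proj_class A = proj_class B \<longleftrightarrow> (\<exists>c. cmod c = 1 \<and> c \<cdot>\<^sub>m A = B)"
proof
  assume "proj_class A = proj_class B"
  moreover have "B \<in> proj_class B" unfolding proj_class_eq[OF B] by (force intro: exI[of _ 1])
  ultimately have "B \<in> proj_class A" by simp
  then show "\<exists>c. cmod c = 1 \<and> c \<cdot>\<^sub>m A = B" unfolding proj_class_eq[OF A] by blast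
next
  assume "\<exists>c. cmod c = 1 \<and> c \<cdot>\<^sub>m A = B"
  then obtain c where c: "cmod c = 1" "c \<cdot>\<^sub>m A = B" by blast
  have c0: "c \<noteq> 0" using c(1) by auto
  have "a \<cdot>\<^sub>m A \<in> proj_class B" if "cmod a = 1" for a
  proof -
    have "a \<cdot>\<^sub>m A = (a / c) \<cdot>\<^sub>m B" unfolding c(2)[symmetric] smult_smult_mat using c0 by simp
    moreover have "cmod (a / c) = 1" using that c(1) by (simp add: norm_divide)
    ultimately show ?thesis unfolding proj_class_eq[OF B] by blast
  qed
  moreover have "b \<cdot>\<^sub>m B \<in> proj_class A" if "cmod b = 1" for b
  proof -
    have "b \<cdot>\<^sub>m B = (b * c) \<cdot>\<^sub>m A" unfolding c(2)[symmetric] smult_smult_mat ..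
    moreover have "cmod (b * c) = 1" using that c(1) by (simp add: norm_mult)
    ultimately show ?thesis unfolding proj_class_eq[OF A] by blast
  qed
  ultimately show "proj_class A = proj_class B" by (auto simp: proj_class_eq A B)
qed

text \<open>If the class of \<open>B\<close> is an involution, then \<open>B\<^sup>2\<close> is a unit scalar, and dividing \<open>B\<close> by a square root of it
  makes the lift involutive.\<close>

lemma involutions_lift:
  assumes "X \<in> involutions PU"
  obtains A where "A \<in> involutives" "X = proj_class A"
proof -
  obtain B where B: "B \<in> U" "X = proj_class B" and XX: "X \<otimes>\<^bsub>PU\<^esub> X = \<one>\<^bsub>PU\<^esub>"
    using assms unfolding involutions_def PU_carrier by auto
  have "proj_class (B * B) = proj_class (1\<^sub>m N)" using XX B proj_class_mult proj_class_one by simp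
  then obtain c where c: "cmod c = 1" "c \<cdot>\<^sub>m (B * B) = 1\<^sub>m N"
    using proj_class_eq_iff[OF U_mult[OF B(1) B(1)] U_one] by blast
  define d where "d = csqrt c"
  have d: "d * d = c" unfolding d_def by (metis power2_csqrt power2_eq_square)
  have "cmod d * cmod d = 1" using d c(1) by (metis norm_mult)
  then have d1: "cmod d = 1" using norm_ge_zero[of d] by (metis abs_of_nonneg power2_eq_square real_sqrt_abs real_sqrt_one)
  have dB: "d \<cdot>\<^sub>m B \<in> U" using U_smult B d1 by simp
  have "(d \<cdot>\<^sub>m B) * (d \<cdot>\<^sub>m B) = c \<cdot>\<^sub>m (B * B)"
    using U_carrier[OF B(1)] d
    by (simp add: mult_smult_assoc_mat[of _ N N _ N] mult_smult_distrib[of _ N N _ N] smult_smult_mat)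
  then have "d \<cdot>\<^sub>m B \<in> involutives" using dB c(2) by (simp add: involutives_def)
  moreover have "X = proj_class (d \<cdot>\<^sub>m B)" using proj_class_eq_iff[OF B(1) dB] d1 B(2) by blast
  ultimately show thesis using that by blast
qed

lemma involutives_product_U: "set As \<subseteq> involutives \<Longrightarrow> foldr (*) As (1\<^sub>m N) \<in> U"
  by (induction As) (auto simp: U_one U_mult involutives_U)

lemma involution_product_lift:
  assumes "is_involution_product PU k X"
  obtains As where "length As = k" "set As \<subseteq> involutives" "X = proj_class (foldr (*) As (1\<^sub>m N))"
proof -
  obtain Xs where Xs: "length Xs = k" "set Xs \<subseteq> involutions PU" "X = foldr (\<otimes>\<^bsub>PU\<^esub>) Xs \<one>\<^bsub>PU\<^esub>"
    using assms unfolding is_involution_product_def by blast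
  have "\<exists>As. length As = length Xs \<and> set As \<subseteq> involutives \<and>
      foldr (\<otimes>\<^bsub>PU\<^esub>) Xs \<one>\<^bsub>PU\<^esub> = proj_class (foldr (*) As (1\<^sub>m N))"
    using Xs(2)
  proof (induction Xs)
    case Nil
    then show ?case using proj_class_one by simp
  next
    case (Cons Y Ys)
    then obtain As where As: "length As = length Ys" "set As \<subseteq> involutives"
      "foldr (\<otimes>\<^bsub>PU\<^esub>) Ys \<one>\<^bsub>PU\<^esub> = proj_class (foldr (*) As (1\<^sub>m N))" by auto
    obtain A where A: "A \<in> involutives" "Y = proj_class A" using involutions_lift Cons.prems by auto
    then show ?case
      using As involutives_U[OF A(1)] involutives_product_U[OF As(2)]
      by (intro exI[of _ "A # As"]) (simp add: proj_class_mult)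
  qed
  then show thesis using that Xs by auto
qed

text \<open>The number of factors may drop because an involutive isometry can be a scalar, which is trivial in the
  projective group.\<close>

lemma involution_product_of_involutives:
  assumes "set As \<subseteq> involutives"
  shows "\<exists>k\<le>length As. is_involution_product PU k (proj_class (foldr (*) As (1\<^sub>m N)))"
  using assms
proof (induction As)
  case Nil
  have "is_involution_product PU 0 (proj_class (1\<^sub>m N))"
    unfolding is_involution_product_def proj_class_one by simp
  then show ?case by auto
next
  case (Cons A As)
  let ?P = "foldr (*) As (1\<^sub>m N)"
  have A: "A \<in> involutives" "A \<in> U" and P: "?P \<in> U"
    using Cons.prems involutives_U involutives_product_U by auto
  obtain k where k: "k \<le> length As" "is_involution_product PU k (proj_class ?P)" using Cons by auto
  have mult: "proj_class (foldr (*) (A # As) (1\<^sub>m N)) = proj_class A \<otimes>\<^bsub>PU\<^esub> proj_class ?P"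
    using proj_class_mult[OF A(2) P] by simp
  show ?case
  proof (cases "proj_class A = \<one>\<^bsub>PU\<^esub>")
    case True
    have "proj_class A \<otimes>\<^bsub>PU\<^esub> proj_class ?P = proj_class (1\<^sub>m N * ?P)" using proj_class_mult[OF U_one P] True proj_class_one by simp
    then have "proj_class (foldr (*) (A # As) (1\<^sub>m N)) = proj_class ?P" using mult U_one_left[OF P] by simp
    then show ?thesis using k by (metis le_SucI length_Cons)
  next
    case False
    have "proj_class A \<in> involutions PU"
      using False A proj_class_mult[OF A(2,2)] proj_class_one involutives_square[OF A(1)]
      by (auto simp: involutions_def PU_carrier)
    then have "is_involution_product PU (Suc k) (proj_class A \<otimes>\<^bsub>PU\<^esub> proj_class ?P)"
      using k(2) unfolding is_involution_product_def
      by (metis (no_types, lifting) foldr_Cons comp_apply insert_subset length_Cons list.simps(15))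
    then show ?thesis using mult k(1) by (metis Suc_le_mono length_Cons)
  qed
qed

theorem PU_involution_product_le_4:
  assumes "X \<in> carrier PU"
  shows "\<exists>k\<le>4. is_involution_product PU k X"
proof -
  obtain g where g: "g \<in> U" "X = proj_class g" using assms PU_carrier by auto
  show ?thesis
  proof (cases "\<exists>c. g = c \<cdot>\<^sub>m 1\<^sub>m N")
    case True
    then obtain c where c: "g = c \<cdot>\<^sub>m 1\<^sub>m N" by blast
    obtain e where e: "e \<in> V" "h e e = - 1" by (rule ex_negative_vector)
    have "g *\<^sub>v e = c \<cdot>\<^sub>v e" using smult_mat_mult_vec[of "1\<^sub>m N" N N e c] e(1) c by simp
    then have "c * cnj c = 1"
      using U_preserves[OF g(1) e(1) e(1)] e by (simp add: h_linear mult.commute)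
    then have "(cmod c)\<^sup>2 = 1" by (metis complex_norm_square of_real_eq_1_iff)
    then have "cmod c = 1" using norm_ge_zero[of c] by (metis abs_of_nonneg real_sqrt_abs real_sqrt_one)
    then have "proj_class (1\<^sub>m N) = proj_class g" using proj_class_eq_iff[OF U_one g(1)] c by blast
    then have "X = \<one>\<^bsub>PU\<^esub>" using g(2) proj_class_one by simp
    then have "is_involution_product PU 0 X"
      unfolding is_involution_product_def by simp
    then show ?thesis by blast
  next
    case False
    then obtain c where c: "cmod c = 1" "four_involutive_product (c \<cdot>\<^sub>m g)"
      using scalar_multiple_four_involutives[OF g(1)] by blast
    then obtain P Q R S where PQRS: "set [P, Q, R, S] \<subseteq> involutives" "c \<cdot>\<^sub>m g = P * (Q * (R * S))"
      unfolding four_involutive_product_def by auto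
    have "c \<cdot>\<^sub>m g = foldr (*) [P, Q, R, S] (1\<^sub>m N)"
      using PQRS involutives_U U_one_right by simp
    moreover have "proj_class g = proj_class (c \<cdot>\<^sub>m g)"
      using proj_class_eq_iff[OF g(1) U_smult[OF g(1) c(1)]] c(1) by blast
    ultimately show ?thesis
      using involution_product_of_involutives[OF PQRS(1)] g(2) by (simp add: numeral_eq_Suc)
  qed
qed

text \<open>Shorter products are padded with the identity, so that only products of exactly three involutive
  isometries have to be excluded.\<close>

theorem PU_not_involution_product_le_3:
  assumes N: "N \<ge> 4"
  shows "\<exists>X\<in>carrier PU. \<not> (\<exists>k\<le>3. is_involution_product PU k X)"
proof -
  obtain g where g: "g \<in> U" and not3: "\<And>c I1 I2 I3. cmod c = 1 \<Longrightarrow> I1 \<in> involutives \<Longrightarrow>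
      I2 \<in> involutives \<Longrightarrow> I3 \<in> involutives \<Longrightarrow> c \<cdot>\<^sub>m g \<noteq> I1 * (I2 * I3)"
    using ex_not_scalar_multiple_three_involutives[OF N] by blast
  have "\<not> is_involution_product PU k (proj_class g)" if k: "k \<le> 3" for k
  proof
    assume "is_involution_product PU k (proj_class g)"
    then obtain As where As: "length As = k" "set As \<subseteq> involutives" "proj_class g = proj_class (foldr (*) As (1\<^sub>m N))"
      by (rule involution_product_lift)
    let ?Bs = "As @ replicate (3 - k) (1\<^sub>m N)"
    have "foldr (*) (replicate j (1\<^sub>m N)) (1\<^sub>m N) = (1\<^sub>m N :: complex mat)" for j
      by (induction j) simp_all
    then have prod: "foldr (*) ?Bs (1\<^sub>m N) = foldr (*) As (1\<^sub>m N)" by simp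
    have "\<exists>I1 I2 I3. Bs = [I1, I2, I3]" if "length Bs = 3" for Bs :: "complex mat list"
      using that by (auto simp: numeral_3_eq_3 length_Suc_conv)
    moreover have "length ?Bs = 3" using As(1) k by simp
    ultimately obtain I1 I2 I3 where Bs: "?Bs = [I1, I2, I3]" by blast
    have "set ?Bs \<subseteq> involutives" using As(2) one_involutive by auto
    then have I: "I1 \<in> involutives" "I2 \<in> involutives" "I3 \<in> involutives" unfolding Bs by auto
    obtain c where c: "cmod c = 1" "c \<cdot>\<^sub>m g = foldr (*) As (1\<^sub>m N)"
      using proj_class_eq_iff[OF g involutives_product_U[OF As(2)]] As(3) by blast
    have "c \<cdot>\<^sub>m g = I1 * (I2 * I3)"
      using c(2) U_one_right[OF involutives_U[OF I(3)]] unfolding prod[symmetric] Bs by simp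
    then show False using not3 c(1) I by blast
  qed
  then show ?thesis using g PU_carrier by blast
qed

end

lemma group_involution_length_eqI:
  assumes le: "\<And>g. g \<in> carrier G \<Longrightarrow> \<exists>k\<le>Suc m. is_involution_product G k g"
    and not_le: "\<exists>g\<in>carrier G. \<not> (\<exists>k\<le>m. is_involution_product G k g)"
  shows "group_involution_length G = enat (Suc m)"
  unfolding group_involution_length_def
proof (rule antisym)
  show "(SUP g\<in>carrier G. involution_length G g) \<le> enat (Suc m)"
  proof (rule SUP_least)
    fix g assume "g \<in> carrier G"
    then obtain k where "k \<le> Suc m" "is_involution_product G k g" using le by blast
    then show "involution_length G g \<le> enat (Suc m)"
      unfolding involution_length_def by (intro INF_lower2[of k]) auto
  qed
  obtain g where g: "g \<in> carrier G" "\<not> (\<exists>k\<le>m. is_involution_product G k g)" using not_le by blast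
  have "enat (Suc m) \<le> involution_length G g"
    unfolding involution_length_def
  proof (rule INF_greatest)
    fix k assume "k \<in> {k. is_involution_product G k g}"
    then have "\<not> k \<le> m" using g(2) by blast
    then show "enat (Suc m) \<le> enat k" by simp
  qed
  then show "enat (Suc m) \<le> (SUP g\<in>carrier G. involution_length G g)"
    using g(1) by (rule SUP_upper2[rotated])
qed

theorem theorem1p1:
  fixes n :: nat and h :: "complex vec \<Rightarrow> complex vec \<Rightarrow> complex"
  assumes "n \<ge> 3"
    and "hermitian_form (n + 1) h"
    and "nondegenerate_form (n + 1) h"
    and "has_signature (n + 1) h n 1"
  shows "group_involution_length (projective_unitary_group (n + 1) h) = 4 \<and>
    (\<forall>g\<in>carrier (projective_unitary_group (n + 1) h).
      \<exists>k\<le>4. is_involution_product (projective_unitary_group (n + 1) h) k g) \<and>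
    (\<exists>g\<in>carrier (projective_unitary_group (n + 1) h).
      \<not> (\<exists>k\<le>3. is_involution_product (projective_unitary_group (n + 1) h) k g))"
proof -
  interpret lorentz_space "n + 1" h
    using assms by unfold_locales simp_all
  have upper: "\<exists>k\<le>4. is_involution_product PU k g" if "g \<in> carrier PU" for g
    using PU_involution_product_le_4[OF that] .
  have lower: "\<exists>g\<in>carrier PU. \<not> (\<exists>k\<le>3. is_involution_product PU k g)"
    using assms(1) by (intro PU_not_involution_product_le_3) simp
  have "group_involution_length PU = enat (Suc 3)"
    by (rule group_involution_length_eqI) (use upper lower in simp_all)
  then have "group_involution_length PU = 4" by (simp add: numeral_eq_enat)
  then show ?thesis using upper lower by blast
qed

end
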